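(* Let $W$ be a radial weight with $m_0=1$, put $s=m_1$, let $0<\rho\le\sqrt s$, and let $B$ be a finite Blaschke product of degree $n\ge1$. If $f,g\in F^2_W$, $g\not\equiv0$, and $f(z)=B(\rho/z)\,g(z)$, then $|f(z)|\le|g(z)|$ for $|z|\ge\rho$ and $\|f\|_W\le\|g\|_W$. Equality $\|f\|_W=\|g\|_W$ holds if and only if $\rho=\sqrt s$, $n=1$ and $g$ is a linear polynomial.
   Context: A radial weight is a measurable function $W\ge0$ on $[0,\infty)$, not almost everywhere zero, whose moments $m_k=\int_0^\infty t^kW(t)\,dt$, $k=0,1,2,\dots$, are all finite. $F^2_W$ is the space of entire functions $f$ with $\|f\|_W^2=\frac1\pi\int_{\mathbb C}|f(z)|^2W(|z|^2)\,dA(z)<\infty$, where $dA$ is area measure on $\mathbb C$. A finite Blaschke product of degree $n$ is a rational function $B(u)=\eta\prod_{j=1}^n\frac{u-\alpha_j}{1-\bar\alpha_ju}$ with $|\eta|=1$ and $|\alpha_j|<1$. The relation $f(z)=B(\rho/z)g(z)$ is an identity of meromorphic functions. "Linear polynomial" means polynomial of degree exactly one. *)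

theory Defs
  imports "HOL-Complex_Analysis.Complex_Analysis"
begin

text \<open>
  A weight lives on the half-line: \<open>W\<close> is a total function on the reals, but its values at
  negative arguments are never used.  Measurability is taken in the sense of Lebesgue.
\<close>

definition moment :: "(real \<Rightarrow> real) \<Rightarrow> nat \<Rightarrow> real" where
  "moment W k = (LINT t|lebesgue_on {0..}. t ^ k * W t)"

definition radial_weight :: "(real \<Rightarrow> real) \<Rightarrow> bool" where
  "radial_weight W \<longleftrightarrow>
     W \<in> borel_measurable (lebesgue_on {0..}) \<and>
     (\<forall>t\<ge>0. W t \<ge> 0) \<and>
     \<not> (AE t in lebesgue_on {0..}. W t = 0) \<and>
     (\<forall>k. integrable (lebesgue_on {0..}) (\<lambda>t. t ^ k * W t))"

text \<open>
  The integrand of the squared norm is nonnegative and, for a radial weight, Lebesgue measurable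
  on the plane, so integrability says exactly that the integral is finite.
\<close>

definition F2 :: "(real \<Rightarrow> real) \<Rightarrow> (complex \<Rightarrow> complex) set" where
  "F2 W = {f. f holomorphic_on UNIV \<and>
              integrable lebesgue (\<lambda>z. (cmod (f z))\<^sup>2 * W ((cmod z)\<^sup>2))}"

definition F2_norm :: "(real \<Rightarrow> real) \<Rightarrow> (complex \<Rightarrow> complex) \<Rightarrow> real" where
  "F2_norm W f = sqrt (1 / pi * (LINT z|lebesgue. (cmod (f z))\<^sup>2 * W ((cmod z)\<^sup>2)))"

text \<open>
  As a function on the plane, a Blaschke product takes the value 0 at its (finitely many) poles,
  because of division by zero.
\<close>

definition finite_blaschke_product :: "nat \<Rightarrow> (complex \<Rightarrow> complex) \<Rightarrow> bool" where
  "finite_blaschke_product n B \<longleftrightarrow>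
     (\<exists>\<eta> \<alpha>. cmod \<eta> = 1 \<and> (\<forall>j\<in>{1..n}. cmod (\<alpha> j) < 1) \<and>
        B = (\<lambda>u. \<eta> * (\<Prod>j=1..n. (u - \<alpha> j) / (1 - cnj (\<alpha> j) * u))))"

text \<open>
  Equality as meromorphic functions on the plane: agreement off a set without limit points.
  The values at the poles, and at \<open>z = 0\<close> for \<open>B (\<rho> / z)\<close>, are thereby disregarded.
\<close>

definition meromorphic_eq :: "(complex \<Rightarrow> complex) \<Rightarrow> (complex \<Rightarrow> complex) \<Rightarrow> bool" where
  "meromorphic_eq f g \<longleftrightarrow> (\<forall>\<^sub>\<approx>z. f z = g z)"

end

theory Submission
  imports Defs
begin

text \<open>
  A zero of \<open>B (\<rho> / z)\<close> at \<open>\<rho> / \<alpha>\<^sub>j\<close> lies outside the disc of radius \<open>\<rho>\<close> and a pole at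
  \<open>b\<^sub>j = cnj \<alpha>\<^sub>j \<rho>\<close> inside it, so nothing cancels and \<open>g = h \<Prod> (z - b\<^sub>j)\<close>, \<open>f = \<eta> h \<Prod> (\<rho> - \<alpha>\<^sub>j z)\<close>
  with \<open>h\<close> entire. Exchanging the factors one at a time, the identity
  \<open>|z - b|\<^sup>2 - |\<rho> - \<alpha> z|\<^sup>2 = (1 - |\<alpha>|\<^sup>2) (|z|\<^sup>2 - \<rho>\<^sup>2)\<close> reduces the claim to
  \<open>\<integral> (|z|\<^sup>2 - \<rho>\<^sup>2) |k|\<^sup>2 d\<mu> \<ge> 0\<close> for \<open>k\<close> entire, where \<open>d\<mu> = W(|z|\<^sup>2) dA\<close>. If \<open>k = \<Sum> a\<^sub>m z\<^sup>m\<close>, orthogonality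
  of monomials turns the integral into \<open>\<Sum> |a\<^sub>m|\<^sup>2 \<integral> |z|\<^sup>2\<^sup>m (|z|\<^sup>2 - \<rho>\<^sup>2) d\<mu>\<close>. Each of these moments is at least
  \<open>\<rho>\<^sup>2\<^sup>m \<integral> (|z|\<^sup>2 - \<rho>\<^sup>2) d\<mu> = \<rho>\<^sup>2\<^sup>m \<pi> (s - \<rho>\<^sup>2)\<close>, strictly if \<open>m \<ge> 1\<close> since \<open>(x - y) (x\<^sup>m - y\<^sup>m) \<ge> 0\<close>.
  Equality therefore forces \<open>s = \<rho>\<^sup>2\<close> and \<open>k\<close> constant.
\<close>

subsection \<open>Area measure on the plane in polar terms\<close>

text \<open>\<open>lborel\<close> is determined by its values on boxes, and a box in the plane is
  the product of the intervals of its real and imaginary parts. This opens the way to iterated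
  integration over the two coordinates.\<close>

lemma lborel_complex_eq_distr:
  "(lborel :: complex measure) = distr (lborel \<Otimes>\<^sub>M lborel) borel (\<lambda>(x, y). Complex x y)"
proof (rule lborel_eqI)
  have m: "(\<lambda>(x, y). Complex x y) \<in> borel_measurable (lborel \<Otimes>\<^sub>M lborel :: (real \<times> real) measure)"
    unfolding case_prod_beta Complex_eq by measurable
  fix l u :: complex
  assume lu: "\<And>b. b \<in> Basis \<Longrightarrow> l \<bullet> b \<le> u \<bullet> b"
  have "(\<lambda>(x, y). Complex x y) -` box l u = {Re l<..<Re u} \<times> {Im l<..<Im u}"
    by (auto simp: in_box_complex_iff)
  then have "emeasure (distr (lborel \<Otimes>\<^sub>M lborel) borel (\<lambda>(x, y). Complex x y)) (box l u)
      = emeasure (lborel \<Otimes>\<^sub>M lborel) ({Re l<..<Re u} \<times> {Im l<..<Im u})"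
    by (subst emeasure_distr[OF m]) (auto simp: space_pair_measure)
  also have "\<dots> = ennreal (\<Prod>b\<in>Basis. (u - l) \<bullet> b)"
    using lu[of 1] lu[of \<i>]
    by (simp add: lborel.emeasure_pair_measure_Times Basis_complex_def ennreal_mult)
  finally show "emeasure (distr (lborel \<Otimes>\<^sub>M lborel) borel (\<lambda>(x, y). Complex x y)) (box l u)
      = (\<Prod>b\<in>Basis. (u - l) \<bullet> b)" .
qed simp

lemma measurable_Complex [measurable (raw)]:
  assumes "f \<in> borel_measurable M" "g \<in> borel_measurable M"
  shows "(\<lambda>x. Complex (f x) (g x)) \<in> borel_measurable M"
  using assms unfolding Complex_eq by measurable

lemma nn_integral_lborel_complex:
  assumes [measurable]: "F \<in> borel_measurable borel"
  shows "(\<integral>\<^sup>+z. F z \<partial>lborel) = (\<integral>\<^sup>+y. \<integral>\<^sup>+x. F (Complex x y) \<partial>lborel \<partial>lborel)" (is ?A)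
    and "(\<integral>\<^sup>+z. F z \<partial>lborel) = (\<integral>\<^sup>+x. \<integral>\<^sup>+y. F (Complex x y) \<partial>lborel \<partial>lborel)" (is ?B)
proof -
  have "(\<integral>\<^sup>+z. F z \<partial>lborel) = (\<integral>\<^sup>+p. F (Complex (fst p) (snd p)) \<partial>(lborel \<Otimes>\<^sub>M lborel))"
    by (subst lborel_complex_eq_distr, subst nn_integral_distr)
       (auto simp: case_prod_beta)
  then show ?A ?B
    using lborel_pair.nn_integral_snd[of "\<lambda>(x, y). F (Complex x y)"]
      lborel.nn_integral_fst[of "\<lambda>p. F (Complex (fst p) (snd p))" lborel]
    by (simp_all add: case_prod_unfold)
qed

text \<open>On each horizontal line the shear is a translation by the constant \<open>a * y\<close>,
  so translation invariance on the real line settles the inner integral. The vertical shear is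
  treated alike with the order of integration reversed.\<close>

lemma nn_integral_lborel_shear_Re:
  fixes a :: real
  assumes [measurable]: "F \<in> borel_measurable borel"
  shows "(\<integral>\<^sup>+z. F (z + of_real (a * Im z)) \<partial>lborel) = (\<integral>\<^sup>+z. F z \<partial>lborel)"
proof -
  have "(\<integral>\<^sup>+x. F (Complex x y + of_real (a * y)) \<partial>lborel) = (\<integral>\<^sup>+x. F (Complex x y) \<partial>lborel)" for y
  proof -
    have "(\<integral>\<^sup>+x. F (Complex x y) \<partial>lborel)
        = (\<integral>\<^sup>+x. F (Complex x y) \<partial>distr lborel borel ((+) (a * y)))"
      by (simp add: lborel_distr_plus)
    also have "\<dots> = (\<integral>\<^sup>+x. F (Complex (a * y + x) y) \<partial>lborel)"
      by (subst nn_integral_distr) auto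
    also have "(\<lambda>x. Complex (a * y + x) y) = (\<lambda>x. Complex x y + of_real (a * y))"
      by (auto simp: complex_eq_iff)
    finally show ?thesis by (simp add: fun_eq_iff)
  qed
  then show ?thesis
    by (simp add: nn_integral_lborel_complex(1))
qed

lemma nn_integral_lborel_shear_Im:
  fixes a :: real
  assumes [measurable]: "F \<in> borel_measurable borel"
  shows "(\<integral>\<^sup>+z. F (z + \<i> * of_real (a * Re z)) \<partial>lborel) = (\<integral>\<^sup>+z. F z \<partial>lborel)"
proof -
  have "(\<integral>\<^sup>+y. F (Complex x y + \<i> * of_real (a * x)) \<partial>lborel) = (\<integral>\<^sup>+y. F (Complex x y) \<partial>lborel)" for x
  proof -
    have "(\<integral>\<^sup>+y. F (Complex x y) \<partial>lborel)
        = (\<integral>\<^sup>+y. F (Complex x y) \<partial>distr lborel borel ((+) (a * x)))"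
      by (simp add: lborel_distr_plus)
    also have "\<dots> = (\<integral>\<^sup>+y. F (Complex x (a * x + y)) \<partial>lborel)"
      by (subst nn_integral_distr) auto
    also have "(\<lambda>y. Complex x (a * x + y)) = (\<lambda>y. Complex x y + \<i> * of_real (a * x))"
      by (auto simp: complex_eq_iff)
    finally show ?thesis by (simp add: fun_eq_iff)
  qed
  then show ?thesis
    by (simp add: nn_integral_lborel_complex(2))
qed

lemma nn_integral_lborel_cis_mult_aux:
  assumes [measurable]: "F \<in> borel_measurable borel" and "cos (t / 2) \<noteq> 0"
  shows "(\<integral>\<^sup>+z. F (cis t * z) \<partial>lborel) = (\<integral>\<^sup>+z. F z \<partial>lborel)"
proof -
  \<comment> \<open>A rotation is a product of three shears, with parameters \<open>- tan (t/2)\<close>, \<open>sin t\<close>, \<open>- tan (t/2)\<close>.\<close>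
  define S where "S = (\<lambda>z. z + of_real (- tan (t / 2) * Im z))"
  define T where "T = (\<lambda>z. z + \<i> * of_real (sin t * Re z))"
  have [measurable]: "S \<in> borel_measurable borel" "T \<in> borel_measurable borel"
    unfolding S_def T_def by measurable
  have half: "sin t = 2 * sin (t/2) * cos (t/2)" "cos t = 1 - 2 * (sin (t/2))\<^sup>2"
    using sin_double[of "t/2"] cos_double_sin[of "t/2"] by auto
  have e1: "tan (t/2) * sin t = 1 - cos t"
    using assms(2) by (simp add: half tan_def power2_eq_square)
  have e2: "tan (t/2) * (1 + cos t) = sin t"
    using assms(2) cos_double_cos[of "t/2"] by (simp add: half(1) tan_def power2_eq_square)
  have rot: "cis t * z = S (T (S z))" for z
  proof (rule complex_eqI)
    have r: "Re (S (T (S z))) = Re z * (1 - tan (t/2) * sin t)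
        - Im z * (tan (t/2) * (2 - tan (t/2) * sin t))"
      by (simp add: S_def T_def algebra_simps)
    have e3: "tan (t/2) * (2 - tan (t/2) * sin t) = sin t"
      using e2 by (simp add: e1)
    show "Re (cis t * z) = Re (S (T (S z)))"
      unfolding r e3 unfolding e1 by (simp add: algebra_simps)
    have "Im (S (T (S z))) = Im z * (1 - tan (t/2) * sin t) + sin t * Re z"
      by (simp add: S_def T_def algebra_simps)
    then show "Im (cis t * z) = Im (S (T (S z)))"
      unfolding e1 by (simp add: algebra_simps)
  qed
  have "(\<integral>\<^sup>+z. F (S (T (S z))) \<partial>lborel) = (\<integral>\<^sup>+z. F (S (T z)) \<partial>lborel)"
  proof -
    have "(\<lambda>z. F (S (T z))) \<in> borel_measurable borel"
      by measurable
    from nn_integral_lborel_shear_Re[OF this, of "- tan (t / 2)"] show ?thesis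
      by (simp only: S_def)
  qed
  also have "\<dots> = (\<integral>\<^sup>+z. F (S z) \<partial>lborel)"
    unfolding T_def by (rule nn_integral_lborel_shear_Im) measurable
  also have "\<dots> = (\<integral>\<^sup>+z. F z \<partial>lborel)"
    unfolding S_def by (rule nn_integral_lborel_shear_Re) measurable
  finally show ?thesis
    unfolding rot .
qed

lemma nn_integral_lborel_cis_mult:
  assumes [measurable]: "F \<in> borel_measurable borel"
  shows "(\<integral>\<^sup>+z. F (cis t * z) \<partial>lborel) = (\<integral>\<^sup>+z. F z \<partial>lborel)"
proof (cases "cos (t / 2) = 0")
  case True
  \<comment> \<open>By the double angle formula cos (t/2) and cos (t/4) cannot both vanish, so the
    rotation by t is carried out as two rotations by t/2.\<close>
  then have "cos ((t / 2) / 2) \<noteq> 0"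
    using cos_double_cos[of "t / 2 / 2"] by auto
  note aux = nn_integral_lborel_cis_mult_aux[OF _ this]
  have "(\<integral>\<^sup>+z. F (cis t * z) \<partial>lborel) = (\<integral>\<^sup>+z. F (cis (t / 2) * (cis (t / 2) * z)) \<partial>lborel)"
    by (simp add: mult.assoc [symmetric] cis_mult)
  also have "\<dots> = (\<integral>\<^sup>+z. F (cis (t / 2) * z) \<partial>lborel)"
    by (rule aux) measurable
  also have "\<dots> = (\<integral>\<^sup>+z. F z \<partial>lborel)"
    by (rule aux) measurable
  finally show ?thesis .
qed (rule nn_integral_lborel_cis_mult_aux[OF assms])

text \<open>This replaces polar coordinates. The disc of squared radius a has area pi a, so both
  measures agree on the half-lines \<open>{..a}\<close>, which generate the Borel sets.\<close>

lemma distr_lborel_cmod_square: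
  "distr (lborel :: complex measure) borel (\<lambda>z. (cmod z)\<^sup>2)
     = density lborel (\<lambda>t. ennreal (pi * indicator {0..} t))"
proof (rule measure_eqI_generator_eq[where E = "range atMost" and \<Omega> = UNIV and A = "\<lambda>i. {..real i}"])
  show "Int_stable (range (atMost :: real \<Rightarrow> _))"
    by (auto simp: Int_stable_def)
  show "sets (distr (lborel :: complex measure) borel (\<lambda>z. (cmod z)\<^sup>2)) = sigma_sets UNIV (range (atMost :: real \<Rightarrow> _))"
    "sets (density lborel (\<lambda>t. ennreal (pi * indicator {0..} t))) = sigma_sets UNIV (range (atMost :: real \<Rightarrow> _))"
    by (simp_all add: borel_eq_atMost)
  show "(\<Union>i. {..real i}) = UNIV"
    by (auto intro: real_arch_simple)
  have L: "emeasure (distr (lborel :: complex measure) borel (\<lambda>z. (cmod z)\<^sup>2)) {..a} = ennreal (pi * max 0 a)" for a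
  proof -
    have "emeasure (distr (lborel :: complex measure) borel (\<lambda>z. (cmod z)\<^sup>2)) {..a}
        = emeasure lborel {z. (cmod z)\<^sup>2 \<le> a}"
      by (subst emeasure_distr) (auto simp: vimage_def)
    also have "\<dots> = ennreal (pi * max 0 a)"
    proof (cases "a \<ge> 0")
      case True
      then have "{z. (cmod z)\<^sup>2 \<le> a} = cball 0 (sqrt a)"
        using real_le_rsqrt sqrt_ge_absD by (fastforce simp: real_sqrt_le_iff)
      then show ?thesis
        using True by (simp add: emeasure_cball unit_ball_vol_2)
    next
      case False
      then have "{z. (cmod z)\<^sup>2 \<le> a} = {}"
        by (smt (verit) Collect_empty_eq zero_le_power2)
      then show ?thesis using False by simp
    qed
    finally show ?thesis .
  qed
  have R: "emeasure (density lborel (\<lambda>t. ennreal (pi * indicator {0..} t))) {..a} = ennreal (pi * max 0 a)" for a :: real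
  proof -
    have "emeasure (density lborel (\<lambda>t. ennreal (pi * indicator {0..} t))) {..a}
        = (\<integral>\<^sup>+t. ennreal pi * indicator {0..a} t \<partial>lborel)"
      by (subst emeasure_density) (auto intro!: nn_integral_cong simp: indicator_def)
    also have "\<dots> = ennreal (pi * max 0 a)"
      by (subst nn_integral_cmult_indicator) (auto simp: ennreal_mult max_def)
    finally show ?thesis .
  qed
  show "emeasure (distr (lborel :: complex measure) borel (\<lambda>z. (cmod z)\<^sup>2)) X
      = emeasure (density lborel (\<lambda>t. ennreal (pi * indicator {0..} t))) X" if "X \<in> range atMost" for X
    using that by (auto simp: L R)
  show "emeasure (distr (lborel :: complex measure) borel (\<lambda>z. (cmod z)\<^sup>2)) {..real i} \<noteq> \<infinity>" for i
    by (simp add: L)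
qed auto

subsection \<open>Entire functions and rotation invariant measures\<close>

text \<open>Convergence at |r| + 1 gives absolute convergence at r. The terms there are eventually
  below 1, hence dominate their own squares.\<close>

lemma summable_norm_square_coeffs:
  fixes a :: "nat \<Rightarrow> complex"
  assumes "\<And>z. (\<lambda>k. a k * z ^ k) sums h z"
  shows "summable (\<lambda>k. (cmod (a k))\<^sup>2 * r ^ (2 * k))"
proof -
  have "summable (\<lambda>k. a k * of_real (\<bar>r\<bar> + 1) ^ k)"
    using assms by (auto simp: summable_def)
  then have s: "summable (\<lambda>k. norm (a k * of_real r ^ k))"
    by (rule powser_insidea) auto
  then have "\<forall>\<^sub>F k in sequentially. norm (a k * of_real r ^ k) < 1"
    by (intro order_tendstoD(2)[OF summable_LIMSEQ_zero]) auto
  then have "\<forall>\<^sub>F k in sequentially. norm ((cmod (a k))\<^sup>2 * r ^ (2 * k)) \<le> norm (a k * of_real r ^ k)"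
  proof eventually_elim
    case (elim k)
    have "norm ((cmod (a k))\<^sup>2 * r ^ (2 * k)) = (norm (a k * of_real r ^ k))\<^sup>2"
      by (simp add: norm_mult norm_power power_mult_distrib power_even_eq abs_mult flip: power_abs)
    also have "\<dots> \<le> norm (a k * of_real r ^ k)"
      unfolding power2_eq_square using elim by (intro mult_left_le) auto
    finally show ?case .
  qed
  then show ?thesis
    using s by (rule summable_comparison_test_ev)
qed

lemma same_sign_square_power_diff:
  fixes x y :: real
  assumes "x \<ge> 0" "y \<ge> 0"
  shows "0 \<le> (x\<^sup>2 - y\<^sup>2) * (x ^ (2 * k) - y ^ (2 * k))"
proof (cases "x \<le> y")
  case True
  then show ?thesis using assms by (intro mult_nonpos_nonpos) (auto intro: power_mono)
next
  case False
  then show ?thesis using assms by (intro mult_nonneg_nonneg) (auto intro: power_mono)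
qed

text \<open>An abstract stand-in for the weighted area measure: its symmetry drives the analytic
  argument, while facts about its second moment enter as hypotheses of the individual
  lemmas.\<close>

locale rotation_invariant_measure = finite_measure \<mu> for \<mu> :: "complex measure" +
  assumes sets_eq_borel [measurable_cong]: "sets \<mu> = sets borel"
    and distr_rotation: "distr \<mu> borel ((*) (cis t)) = \<mu>"
begin

lemma integral_rotation:
  fixes F :: "complex \<Rightarrow> 'b::{banach, second_countable_topology}"
  assumes [measurable]: "F \<in> borel_measurable borel"
  shows "(LINT z|\<mu>. F (cis t * z)) = (LINT z|\<mu>. F z)"
proof -
  have "(LINT z|\<mu>. F z) = (LINT z|distr \<mu> borel ((*) (cis t)). F z)"
    by (simp add: distr_rotation)
  also have "\<dots> = (LINT z|\<mu>. F (cis t * z))"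
    by (rule integral_distr) auto
  finally show ?thesis ..
qed

text \<open>Rotation by the angle pi / (j - k) multiplies the integrand by exp (i pi) = -1, so the
  integral equals its own negative.\<close>

lemma monomials_orthogonal:
  assumes [measurable]: "\<phi> \<in> borel_measurable borel"
    and radial: "\<And>z w. cmod z = cmod w \<Longrightarrow> \<phi> z = (\<phi> w :: real)" and "j \<noteq> k"
  shows "(LINT z|\<mu>. of_real (\<phi> z) * (z ^ j * cnj z ^ k)) = 0"
proof -
  have [measurable]: "cnj \<in> borel_measurable borel"
    by (intro borel_measurable_continuous_onI continuous_intros)
  define t where "t = pi / (real j - real k)"
  have "of_real (\<phi> (cis t * z)) * ((cis t * z) ^ j * cnj (cis t * z) ^ k)
      = - (of_real (\<phi> z) * (z ^ j * cnj z ^ k))" for z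
  proof -
    have "real j * t + real k * (- t) = (real j - real k) * t"
      by (simp add: left_diff_distrib)
    then have "real j * t + real k * (- t) = pi"
      using \<open>j \<noteq> k\<close> by (simp add: t_def)
    then have "cis t ^ j * cis (- t) ^ k = -1"
      by (simp only: Complex.DeMoivre cis_mult cis_pi)
    moreover have "\<phi> (cis t * z) = \<phi> z"
      by (rule radial) (simp add: norm_mult)
    ultimately show ?thesis
      by (simp add: power_mult_distrib cis_cnj mult_ac)
  qed
  then have "(LINT z|\<mu>. of_real (\<phi> z) * (z ^ j * cnj z ^ k))
      = - (LINT z|\<mu>. of_real (\<phi> z) * (z ^ j * cnj z ^ k))"
    using integral_rotation[of "\<lambda>z. of_real (\<phi> z) * (z ^ j * cnj z ^ k)" t] by simp
  then show ?thesis by simp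
qed

end

section \<open>Power series integrated against a compactly supported radial factor\<close>

locale radial_cutoff = rotation_invariant_measure +
  fixes \<phi> :: "complex \<Rightarrow> real" and R C :: real
  assumes cutoff_measurable [measurable]: "\<phi> \<in> borel_measurable borel"
    and radial: "cmod z = cmod w \<Longrightarrow> \<phi> z = \<phi> w"
    and bounded: "\<bar>\<phi> z\<bar> \<le> C"
    and support: "cmod z > R \<Longrightarrow> \<phi> z = 0"
    and radius_nonneg: "R \<ge> 0"
begin

lemma integrable_cutoff:
  fixes F :: "complex \<Rightarrow> 'b::{euclidean_space, second_countable_topology}"
  assumes "continuous_on UNIV F"
  shows "integrable \<mu> (\<lambda>z. \<phi> z *\<^sub>R F z)"
proof -
  have [measurable]: "F \<in> borel_measurable borel"
    by (rule borel_measurable_continuous_onI[OF assms])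
  have "compact (F ` cball 0 R)"
    by (intro compact_continuous_image continuous_on_subset[OF assms]) auto
  then obtain M where "\<forall>w\<in>F ` cball 0 R. norm w \<le> M"
    using compact_imp_bounded bounded_iff by blast
  then have M: "\<And>z. z \<in> cball 0 R \<Longrightarrow> norm (F z) \<le> M"
    by simp
  have "C \<ge> 0" using bounded[of 0] by linarith
  have "norm (\<phi> z *\<^sub>R F z) \<le> C * M" for z
  proof (cases "cmod z \<le> R")
    case True
    then show ?thesis
      using M[of z] bounded[of z] \<open>C \<ge> 0\<close> by (auto intro!: mult_mono)
  next
    case False
    \<comment> \<open>Outside the disc the claim becomes 0 \<le> \<open>C * M\<close>. That
      \<open>M\<close> is nonnegative is read off at the centre, which lies in the disc since
      \<open>R\<close> is nonnegative.\<close>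
    have "norm (F 0) \<le> M" using M[of 0] radius_nonneg by simp
    then have "M \<ge> 0" using norm_ge_zero order_trans by blast
    then show ?thesis
      using support[of z] False \<open>C \<ge> 0\<close> by simp
  qed
  then show ?thesis
    by (intro integrable_const_bound[where B = "C * M"]) auto
qed

text \<open>Parseval for polynomials. The squared modulus is expanded as a complex double sum, whose
  off-diagonal terms integrate to 0 by \<open>monomials_orthogonal\<close>; injectivity of
  \<open>of_real\<close> leads back to the reals.\<close>

lemma integral_cutoff_polynomial:
  "(LINT z|\<mu>. \<phi> z * (cmod (\<Sum>k<n. a k * z ^ k))\<^sup>2)
     = (\<Sum>k<n. (cmod (a k))\<^sup>2 * (LINT z|\<mu>. \<phi> z * (cmod z) ^ (2 * k)))"
proof -
  have int: "integrable \<mu> (\<lambda>z. of_real (\<phi> z) * (z ^ j * cnj z ^ k))" for j k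
  proof -
    have "continuous_on UNIV (\<lambda>z. z ^ j * cnj z ^ k)"
      by (intro continuous_intros)
    from integrable_cutoff[OF this] show ?thesis
      by (simp only: scaleR_conv_of_real)
  qed
  have "of_real (\<phi> z * (cmod (\<Sum>k<n. a k * z ^ k))\<^sup>2)
      = (\<Sum>j<n. \<Sum>k<n. a j * cnj (a k) * (of_real (\<phi> z) * (z ^ j * cnj z ^ k)))" for z
    unfolding of_real_mult complex_norm_square cnj_sum sum_product
    unfolding sum_distrib_left by (intro sum.cong) (simp_all add: mult_ac)
  then have "complex_of_real (LINT z|\<mu>. \<phi> z * (cmod (\<Sum>k<n. a k * z ^ k))\<^sup>2)
      = (LINT z|\<mu>. (\<Sum>j<n. \<Sum>k<n. a j * cnj (a k) * (of_real (\<phi> z) * (z ^ j * cnj z ^ k))))"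
    unfolding integral_complex_of_real [symmetric] by (simp only:)
  also have "\<dots> = (\<Sum>j<n. \<Sum>k<n. a j * cnj (a k) * (LINT z|\<mu>. of_real (\<phi> z) * (z ^ j * cnj z ^ k)))"
    by (simp only: Bochner_Integration.integral_sum Bochner_Integration.integrable_sum
        integrable_mult_right[OF int] integral_mult_right_zero)
  also have "\<dots> = (\<Sum>j<n. a j * cnj (a j) * (LINT z|\<mu>. of_real (\<phi> z) * (z ^ j * cnj z ^ j)))"
  proof (rule sum.cong[OF refl])
    fix j assume "j \<in> {..<n}"
    have "(\<Sum>k<n. a j * cnj (a k) * (LINT z|\<mu>. of_real (\<phi> z) * (z ^ j * cnj z ^ k)))
      = (\<Sum>k<n. if k = j then a j * cnj (a j) * (LINT z|\<mu>. of_real (\<phi> z) * (z ^ j * cnj z ^ j)) else 0)"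
      using monomials_orthogonal[OF cutoff_measurable radial] by (intro sum.cong) auto
    then show "(\<Sum>k<n. a j * cnj (a k) * (LINT z|\<mu>. of_real (\<phi> z) * (z ^ j * cnj z ^ k)))
        = a j * cnj (a j) * (LINT z|\<mu>. of_real (\<phi> z) * (z ^ j * cnj z ^ j))"
      using \<open>j \<in> {..<n}\<close> by simp
  qed
  also have "\<dots> = of_real (\<Sum>k<n. (cmod (a k))\<^sup>2 * (LINT z|\<mu>. \<phi> z * (cmod z) ^ (2 * k)))"
  proof -
    have "z ^ j * cnj z ^ j = complex_of_real ((cmod z) ^ (2 * j))" for z j
      by (simp only: power_mult of_real_power[of "(cmod z)\<^sup>2"] complex_norm_square power_mult_distrib)
    then have "(LINT z|\<mu>. of_real (\<phi> z) * (z ^ j * cnj z ^ j))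
        = of_real (LINT z|\<mu>. \<phi> z * (cmod z) ^ (2 * j))" for j
      by (simp only: of_real_mult [symmetric] integral_complex_of_real)
    then show ?thesis
      by (simp only: of_real_sum of_real_mult complex_norm_square)
  qed
  finally show ?thesis
    by (simp only: of_real_eq_iff)
qed

text \<open>Dominated convergence: on the support of \<open>\<phi>\<close> all partial sums are
  bounded by \<open>M\<close>, the sum of |a_k| R^k, and the constant \<open>C * M\<^sup>2\<close>
  is integrable because the measure is finite.\<close>

lemma integral_cutoff_power_series:
  assumes sums: "\<And>z. (\<lambda>k. a k * z ^ k) sums h z"
  shows "(\<lambda>n. \<Sum>k<n. (cmod (a k))\<^sup>2 * (LINT z|\<mu>. \<phi> z * (cmod z) ^ (2 * k)))
           \<longlonglongrightarrow> (LINT z|\<mu>. \<phi> z * (cmod (h z))\<^sup>2)"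
proof -
  define M where "M = (\<Sum>k. cmod (a k) * R ^ k)"
  have summ: "summable (\<lambda>k. cmod (a k) * R ^ k)"
  proof -
    have "summable (\<lambda>k. a k * of_real (R + 1) ^ k)"
      using sums by (auto simp: summable_def)
    then have "summable (\<lambda>k. norm (a k * of_real R ^ k))"
      by (rule powser_insidea) (use radius_nonneg in auto)
    then show ?thesis
      using radius_nonneg by (simp add: norm_mult norm_power)
  qed
  have lim: "(\<lambda>n. \<Sum>k<n. a k * z ^ k) \<longlonglongrightarrow> h z" for z
    using sums[of z] by (simp add: sums_def)
  have [measurable]: "h \<in> borel_measurable borel"
    by (rule borel_measurable_LIMSEQ_metric[OF _ lim]) measurable
  have bd: "cmod (\<Sum>k<n. a k * z ^ k) \<le> M" if "cmod z \<le> R" for z n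
  proof -
    have "cmod (\<Sum>k<n. a k * z ^ k) \<le> (\<Sum>k<n. cmod (a k) * R ^ k)"
      using that by (intro sum_norm_le) (auto simp: norm_mult norm_power intro!: mult_left_mono power_mono)
    also have "\<dots> \<le> M"
      unfolding M_def using summ radius_nonneg by (intro sum_le_suminf) auto
    finally show ?thesis .
  qed
  have "C \<ge> 0" using bounded[of 0] by linarith
  have "(\<lambda>n. LINT z|\<mu>. \<phi> z * (cmod (\<Sum>k<n. a k * z ^ k))\<^sup>2) \<longlonglongrightarrow> (LINT z|\<mu>. \<phi> z * (cmod (h z))\<^sup>2)"
  proof (rule integral_dominated_convergence[where w = "\<lambda>_. C * M\<^sup>2"])
    show "AE z in \<mu>. (\<lambda>n. \<phi> z * (cmod (\<Sum>k<n. a k * z ^ k))\<^sup>2) \<longlonglongrightarrow> \<phi> z * (cmod (h z))\<^sup>2"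
      by (intro AE_I2 tendsto_intros lim)
    show "AE z in \<mu>. norm (\<phi> z * (cmod (\<Sum>k<n. a k * z ^ k))\<^sup>2) \<le> C * M\<^sup>2" for n
    proof (rule AE_I2)
      fix z
      show "norm (\<phi> z * (cmod (\<Sum>k<n. a k * z ^ k))\<^sup>2) \<le> C * M\<^sup>2"
      proof (cases "cmod z \<le> R")
        case True
        then show ?thesis
          using bd[OF True, of n] bounded[of z] \<open>C \<ge> 0\<close>
          by (auto simp: abs_mult intro!: mult_mono power_mono)
      next
        case False
        then show ?thesis
          using support[of z] \<open>C \<ge> 0\<close> by simp
      qed
    qed
  qed auto
  then show ?thesis
    by (simp add: integral_cutoff_polynomial)
qed

text \<open>Writing |z|^(2k) as \<rho>^(2k) plus a remainder splits each coefficient integral in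
  two. The remainder has the sign of |z|^2 - \<rho>^2, so its integral against \<open>\<phi>\<close>
  is nonnegative, and all but the m-th are dropped. That one is kept because it forces the m-th
  coefficient to vanish in the case of equality.\<close>

lemma integral_cutoff_lower_bound:
  assumes sums: "\<And>z. (\<lambda>k. a k * z ^ k) sums h z"
    and \<phi>: "\<And>z. \<phi> z = indicator (cball 0 R) z * ((cmod z)\<^sup>2 - \<rho>\<^sup>2)" and "\<rho> \<ge> 0"
  shows "(\<Sum>k. (cmod (a k))\<^sup>2 * \<rho> ^ (2 * k)) * (LINT z|\<mu>. \<phi> z)
           + (cmod (a m))\<^sup>2 * (LINT z|\<mu>. \<phi> z * ((cmod z) ^ (2 * m) - \<rho> ^ (2 * m)))
         \<le> (LINT z|\<mu>. \<phi> z * (cmod (h z))\<^sup>2)"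
proof (rule tendsto_le[OF sequentially_bot integral_cutoff_power_series[OF sums]])
  let ?d = "\<lambda>k. LINT z|\<mu>. \<phi> z * ((cmod z) ^ (2 * k) - \<rho> ^ (2 * k))"
  let ?S = "\<lambda>n. \<Sum>k<n. (cmod (a k))\<^sup>2 * \<rho> ^ (2 * k)"
  show "(\<lambda>n. ?S n * (LINT z|\<mu>. \<phi> z) + (cmod (a m))\<^sup>2 * ?d m)
      \<longlonglongrightarrow> (\<Sum>k. (cmod (a k))\<^sup>2 * \<rho> ^ (2 * k)) * (LINT z|\<mu>. \<phi> z) + (cmod (a m))\<^sup>2 * ?d m"
    by (intro tendsto_intros summable_LIMSEQ summable_norm_square_coeffs[OF sums])
  have int: "integrable \<mu> (\<lambda>z. \<phi> z * F z)" if "continuous_on UNIV F" for F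
    using integrable_cutoff[OF that] by simp
  have split: "(LINT z|\<mu>. \<phi> z * (cmod z) ^ (2 * k)) = \<rho> ^ (2 * k) * (LINT z|\<mu>. \<phi> z) + ?d k" for k
  proof -
    have "(LINT z|\<mu>. \<phi> z * (cmod z) ^ (2 * k))
        = (LINT z|\<mu>. \<rho> ^ (2 * k) * \<phi> z + \<phi> z * ((cmod z) ^ (2 * k) - \<rho> ^ (2 * k)))"
      by (simp add: algebra_simps)
    also have "\<dots> = \<rho> ^ (2 * k) * (LINT z|\<mu>. \<phi> z) + ?d k"
    proof -
      have "integrable \<mu> \<phi>"
        using int[of "\<lambda>_. 1"] by simp
      moreover have "integrable \<mu> (\<lambda>z. \<phi> z * ((cmod z) ^ (2 * k) - \<rho> ^ (2 * k)))"
        by (intro int continuous_intros)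
      ultimately show ?thesis
        by (subst Bochner_Integration.integral_add) auto
    qed
    finally show ?thesis .
  qed
  have nonneg: "?d k \<ge> 0" for k
  proof (rule Bochner_Integration.integral_nonneg)
    fix z
    show "0 \<le> \<phi> z * ((cmod z) ^ (2 * k) - \<rho> ^ (2 * k))"
      unfolding \<phi> mult.assoc using same_sign_square_power_diff[of "cmod z" \<rho> k] \<open>\<rho> \<ge> 0\<close>
      by (simp add: indicator_def)
  qed
  show "\<forall>\<^sub>F n in sequentially. ?S n * (LINT z|\<mu>. \<phi> z) + (cmod (a m))\<^sup>2 * ?d m
      \<le> (\<Sum>k<n. (cmod (a k))\<^sup>2 * (LINT z|\<mu>. \<phi> z * (cmod z) ^ (2 * k)))"
  \<comment> \<open>From \<open>Suc m\<close> on, the index m belongs to the range of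
    summation.\<close>
  proof (rule eventually_sequentiallyI[of "Suc m"])
    fix n assume "Suc m \<le> n"
    then have "(cmod (a m))\<^sup>2 * ?d m \<le> (\<Sum>k<n. (cmod (a k))\<^sup>2 * ?d k)"
      using nonneg by (intro member_le_sum) auto
    then show "?S n * (LINT z|\<mu>. \<phi> z) + (cmod (a m))\<^sup>2 * ?d m
        \<le> (\<Sum>k<n. (cmod (a k))\<^sup>2 * (LINT z|\<mu>. \<phi> z * (cmod z) ^ (2 * k)))"
      unfolding split by (simp add: algebra_simps sum.distrib sum_distrib_left)
  qed
qed

end

section \<open>Passage from discs to the whole plane\<close>

context rotation_invariant_measure
begin

lemma disc_cutoff:
  assumes "r \<ge> 0"
  shows "radial_cutoff \<mu> (\<lambda>z. indicator (cball 0 r) z * ((cmod z)\<^sup>2 - \<rho>\<^sup>2)) r (r\<^sup>2 + \<rho>\<^sup>2)"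
proof
  show "(\<lambda>z. indicator (cball 0 r) z * ((cmod z)\<^sup>2 - \<rho>\<^sup>2)) \<in> borel_measurable borel"
    by (intro borel_measurable_times borel_measurable_indicator) auto
  fix z :: complex
  have "\<bar>(cmod z)\<^sup>2 - \<rho>\<^sup>2\<bar> \<le> r\<^sup>2 + \<rho>\<^sup>2" if "cmod z \<le> r"
    using power_mono[OF that norm_ge_zero, of 2] by (smt (verit) zero_le_power2)
  then show "\<bar>indicator (cball 0 r) z * ((cmod z)\<^sup>2 - \<rho>\<^sup>2)\<bar> \<le> r\<^sup>2 + \<rho>\<^sup>2"
    by (auto simp: indicator_def)
qed (use assms in \<open>auto simp: indicator_def\<close>)

lemma integrable_disc_square_power_diff:
  assumes "r \<ge> 0"
  shows "integrable \<mu> (\<lambda>z. indicator (cball 0 r) z *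
           (((cmod z)\<^sup>2 - \<rho>\<^sup>2) * ((cmod z) ^ (2 * m) - \<rho> ^ (2 * m))))"
proof -
  interpret radial_cutoff \<mu> "\<lambda>z. indicator (cball 0 r) z * ((cmod z)\<^sup>2 - \<rho>\<^sup>2)" r "r\<^sup>2 + \<rho>\<^sup>2"
    using assms by (rule disc_cutoff)
  have "continuous_on UNIV (\<lambda>z::complex. (cmod z) ^ (2 * m) - \<rho> ^ (2 * m))"
    by (intro continuous_intros)
  from integrable_cutoff[OF this] show ?thesis
    by (simp only: real_scaleR_def mult.assoc)
qed

lemma tendsto_integral_discs:
  fixes F :: "complex \<Rightarrow> real"
  assumes "integrable \<mu> F"
  shows "(\<lambda>n. LINT z|\<mu>. indicator (cball 0 (real n)) z * F z) \<longlonglongrightarrow> (LINT z|\<mu>. F z)"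
proof (rule integral_dominated_convergence[where w = "\<lambda>z. \<bar>F z\<bar>"])
  show "F \<in> borel_measurable \<mu>"
    using assms by auto
  then show "(\<lambda>z. indicator (cball 0 (real n)) z * F z) \<in> borel_measurable \<mu>" for n
    by (intro borel_measurable_times borel_measurable_indicator) (auto simp: sets_eq_borel)
  show "AE z in \<mu>. (\<lambda>n. indicator (cball 0 (real n)) z * F z) \<longlonglongrightarrow> F z"
  proof (rule AE_I2, rule tendsto_eventually)
    fix z
    obtain N where "cmod z \<le> real N"
      using real_arch_simple by blast
    then show "\<forall>\<^sub>F n in sequentially. indicator (cball 0 (real n)) z * F z = F z"
      by (intro eventually_sequentiallyI[of N]) (auto simp: indicator_def)
  qed
qed (use assms in \<open>auto simp: indicator_def\<close>)

text \<open>The discs grow to the plane while the m-th remainder stays on a fixed disc: its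
  integrand is nonnegative, so it is at most the remainder on any larger disc. In this form the
  bound involves no integral of a higher power of |z| over the plane.\<close>

lemma integral_power_series_lower_bound:
  assumes sums: "\<And>z. (\<lambda>k. a k * z ^ k) sums h z" and "\<rho> \<ge> 0" "r \<ge> 0"
    and int: "integrable \<mu> (\<lambda>z. ((cmod z)\<^sup>2 - \<rho>\<^sup>2) * (cmod (h z))\<^sup>2)"
    and int2: "integrable \<mu> (\<lambda>z. (cmod z)\<^sup>2)"
  shows "(\<Sum>k. (cmod (a k))\<^sup>2 * \<rho> ^ (2 * k)) * (LINT z|\<mu>. (cmod z)\<^sup>2 - \<rho>\<^sup>2)
           + (cmod (a m))\<^sup>2 * (LINT z|\<mu>. indicator (cball 0 r) z *
               (((cmod z)\<^sup>2 - \<rho>\<^sup>2) * ((cmod z) ^ (2 * m) - \<rho> ^ (2 * m))))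
         \<le> (LINT z|\<mu>. ((cmod z)\<^sup>2 - \<rho>\<^sup>2) * (cmod (h z))\<^sup>2)" (is "?S * ?C + ?am * ?d r \<le> ?I")
proof (rule tendsto_le[OF sequentially_bot tendsto_integral_discs[OF int]])
  have "integrable \<mu> (\<lambda>z. (cmod z)\<^sup>2 - \<rho>\<^sup>2)"
    using int2 by simp
  then show "(\<lambda>n. ?S * (LINT z|\<mu>. indicator (cball 0 (real n)) z * ((cmod z)\<^sup>2 - \<rho>\<^sup>2)) + ?am * ?d r)
      \<longlonglongrightarrow> ?S * ?C + ?am * ?d r"
    by (intro tendsto_intros tendsto_integral_discs)
  obtain N where N: "r \<le> real N"
    using real_arch_simple by blast
  show "\<forall>\<^sub>F n in sequentially. ?S * (LINT z|\<mu>. indicator (cball 0 (real n)) z * ((cmod z)\<^sup>2 - \<rho>\<^sup>2)) + ?am * ?d r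
      \<le> (LINT z|\<mu>. indicator (cball 0 (real n)) z * (((cmod z)\<^sup>2 - \<rho>\<^sup>2) * (cmod (h z))\<^sup>2))"
  proof (rule eventually_sequentiallyI[of N])
    fix n assume "N \<le> n"
    with N have "r \<le> real n" by linarith
    have "?d r \<le> ?d n"
    proof (rule integral_mono[OF integrable_disc_square_power_diff integrable_disc_square_power_diff])
      fix z
      show "indicator (cball 0 r) z * (((cmod z)\<^sup>2 - \<rho>\<^sup>2) * ((cmod z) ^ (2 * m) - \<rho> ^ (2 * m)))
        \<le> indicator (cball 0 (real n)) z * (((cmod z)\<^sup>2 - \<rho>\<^sup>2) * ((cmod z) ^ (2 * m) - \<rho> ^ (2 * m)))"
        using \<open>r \<le> real n\<close> same_sign_square_power_diff[of "cmod z" \<rho> m] \<open>\<rho> \<ge> 0\<close>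
        by (intro mult_right_mono) (auto simp: indicator_def)
    qed (use \<open>r \<ge> 0\<close> in auto)
    then have "?am * ?d r \<le> ?am * ?d n"
      by (intro mult_left_mono) auto
    moreover interpret radial_cutoff \<mu> "\<lambda>z. indicator (cball 0 (real n)) z * ((cmod z)\<^sup>2 - \<rho>\<^sup>2)" "real n" "(real n)\<^sup>2 + \<rho>\<^sup>2"
      by (rule disc_cutoff) simp
    note integral_cutoff_lower_bound[OF sums refl \<open>\<rho> \<ge> 0\<close>, of m]
    ultimately show "?S * (LINT z|\<mu>. indicator (cball 0 (real n)) z * ((cmod z)\<^sup>2 - \<rho>\<^sup>2)) + ?am * ?d r
      \<le> (LINT z|\<mu>. indicator (cball 0 (real n)) z * (((cmod z)\<^sup>2 - \<rho>\<^sup>2) * (cmod (h z))\<^sup>2))"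
      by (simp only: mult.assoc)
  qed
qed

text \<open>Both summands of the lower bound are nonnegative, so a vanishing integral makes both
  vanish for every m. The first gives \<open>?C = 0\<close>, since \<open>?S\<close> is positive for
  h nonzero and \<rho> > 0. The second gives a_m = 0 for m \<ge> 1, since otherwise the measure
  would live on the circle of radius \<rho>.\<close>

theorem integral_entire_nonneg:
  assumes "h holomorphic_on UNIV" and "\<rho> > 0"
    and int: "integrable \<mu> (\<lambda>z. ((cmod z)\<^sup>2 - \<rho>\<^sup>2) * (cmod (h z))\<^sup>2)"
    and int2: "integrable \<mu> (\<lambda>z. (cmod z)\<^sup>2)"
    and C: "0 \<le> (LINT z|\<mu>. (cmod z)\<^sup>2 - \<rho>\<^sup>2)"
  shows "0 \<le> (LINT z|\<mu>. ((cmod z)\<^sup>2 - \<rho>\<^sup>2) * (cmod (h z))\<^sup>2)"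
    and "(LINT z|\<mu>. ((cmod z)\<^sup>2 - \<rho>\<^sup>2) * (cmod (h z))\<^sup>2) = 0 \<Longrightarrow>
         \<not> (AE z in \<mu>. cmod z = \<rho>) \<Longrightarrow> h \<noteq> (\<lambda>_. 0) \<Longrightarrow>
         (LINT z|\<mu>. (cmod z)\<^sup>2 - \<rho>\<^sup>2) = 0 \<and> (\<exists>c. h = (\<lambda>_. c))"
proof -
  define a where "a k = (deriv ^^ k) h 0 / fact k" for k
  \<comment> \<open>The disc of radius |z| + 1 about 0 contains z, so one expansion at 0 serves
    every point.\<close>
  have sums: "(\<lambda>k. a k * z ^ k) sums h z" for z
    using holomorphic_power_series[of h 0 "cmod z + 1" z] assms(1)
    by (auto simp: a_def intro: holomorphic_on_subset)
  let ?S = "\<Sum>k. (cmod (a k))\<^sup>2 * \<rho> ^ (2 * k)"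
  let ?C = "LINT z|\<mu>. (cmod z)\<^sup>2 - \<rho>\<^sup>2"
  let ?I = "LINT z|\<mu>. ((cmod z)\<^sup>2 - \<rho>\<^sup>2) * (cmod (h z))\<^sup>2"
  let ?D = "\<lambda>m z. ((cmod z)\<^sup>2 - \<rho>\<^sup>2) * ((cmod z) ^ (2 * m) - \<rho> ^ (2 * m))"
  have D: "0 \<le> ?D m z" for m z
    using \<open>\<rho> > 0\<close> by (intro same_sign_square_power_diff) auto
  have summ: "summable (\<lambda>k. (cmod (a k))\<^sup>2 * \<rho> ^ (2 * k))"
    by (rule summable_norm_square_coeffs[OF sums])
  have S: "0 \<le> ?S"
    using \<open>\<rho> > 0\<close> by (intro suminf_nonneg summ) auto
  have low: "?S * ?C + (cmod (a m))\<^sup>2 * (LINT z|\<mu>. indicator (cball 0 (real r)) z * ?D m z) \<le> ?I" for m r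
    using integral_power_series_lower_bound[OF sums _ _ int int2, of "real r" m] \<open>\<rho> > 0\<close> by simp
  have d: "0 \<le> (LINT z|\<mu>. indicator (cball 0 (real r)) z * ?D m z)" for m r
    using D by (intro Bochner_Integration.integral_nonneg) auto
  have "0 \<le> ?S * ?C + (cmod (a 0))\<^sup>2 * (LINT z|\<mu>. indicator (cball 0 (real 0)) z * ?D 0 z)"
    using S C d by (intro add_nonneg_nonneg mult_nonneg_nonneg) auto
  then show "0 \<le> ?I"
    using low[of 0 0] by linarith
  assume I: "?I = 0" and nAE: "\<not> (AE z in \<mu>. cmod z = \<rho>)" and h: "h \<noteq> (\<lambda>_. 0)"
  have zero: "?S * ?C = 0 \<and> (cmod (a m))\<^sup>2 * (LINT z|\<mu>. indicator (cball 0 (real r)) z * ?D m z) = 0" for m r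
    using low[of m r] I mult_nonneg_nonneg[OF S C] mult_nonneg_nonneg[OF zero_le_power2 d, of "cmod (a m)" r m]
    by linarith
  have "\<exists>k. a k \<noteq> 0"
  proof (rule ccontr)
    assume "\<nexists>k. a k \<noteq> 0"
    then have "h z = 0" for z
      using sums[of z] by (simp add: sums_iff)
    with h show False by auto
  qed
  then obtain k where "a k \<noteq> 0" ..
  then have "0 < ?S"
    using \<open>\<rho> > 0\<close> by (intro suminf_pos2[OF summ, of k]) auto
  then have "?C = 0"
    using zero[of 0 0] by simp
  have high: "a m = 0" if "m \<ge> 1" for m
  proof (rule ccontr)
    assume "a m \<noteq> 0"
    then have "(LINT z|\<mu>. indicator (cball 0 (real r)) z * ?D m z) = 0" for r
      using zero[of m r] by simp
    moreover have "integrable \<mu> (\<lambda>z. indicator (cball 0 (real r)) z * ?D m z)" for r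
      by (rule integrable_disc_square_power_diff) simp
    ultimately have "AE z in \<mu>. indicator (cball 0 (real r)) z * ?D m z = 0" for r
      using D by (subst (asm) integral_nonneg_eq_0_iff_AE) auto
    \<comment> \<open>The radii are natural numbers, so the countably many exceptional null sets can
      be merged before a disc containing z is chosen.\<close>
    then have "AE z in \<mu>. \<forall>r. indicator (cball 0 (real r)) z * ?D m z = 0"
      by (subst AE_all_countable) blast
    then have "AE z in \<mu>. cmod z = \<rho>"
    proof (eventually_elim)
      case (elim z)
      obtain N where "cmod z \<le> real N"
        using real_arch_simple by blast
      with elim[rule_format, of N] have "?D m z = 0"
        by simp
      then have "(cmod z)\<^sup>2 = \<rho>\<^sup>2 \<or> (cmod z) ^ (2 * m) = \<rho> ^ (2 * m)"
        by simp
      then show ?case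
        using \<open>\<rho> > 0\<close> \<open>m \<ge> 1\<close> by (auto simp: power_eq_iff_eq_base)
    qed
    with nAE show False ..
  qed
  have "h z = a 0" for z
    using sums_unique2[OF sums[of z] sums_finite[of "{0}" "\<lambda>k. a k * z ^ k"]] high by (auto simp: Suc_le_eq)
  then show "?C = 0 \<and> (\<exists>c. h = (\<lambda>_. c))"
    using \<open>?C = 0\<close> by auto
qed

end

subsection \<open>Exchanging Blaschke factors\<close>

text \<open>A meromorphic identity is known only off an exceptional set; once denominators are
  cleared, continuity carries it to every point.\<close>

lemma continuous_eqI_eventually_at:
  fixes F G :: "complex \<Rightarrow> complex"
  assumes "continuous_on UNIV F" "continuous_on UNIV G" "\<forall>\<^sub>F w in at z. F w = G w"
  shows "F z = G z"
proof (rule tendsto_unique[of "at z"])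
  show "(F \<longlongrightarrow> F z) (at z)"
    using assms(1) by (simp add: continuous_on_def)
  have "(G \<longlongrightarrow> G z) (at z)"
    using assms(2) by (simp add: continuous_on_def)
  then show "(F \<longlongrightarrow> G z) (at z)"
    using tendsto_cong[OF assms(3)] by blast
qed auto

lemma continuous_eqI_off_point:
  fixes F G :: "complex \<Rightarrow> complex"
  assumes "continuous_on UNIV F" "continuous_on UNIV G" "\<And>w. w \<noteq> b \<Longrightarrow> F w = G w"
  shows "F z = G z"
proof (cases "z = b")
  case True
  have "\<forall>\<^sub>F w in at z. w \<noteq> b"
    by (simp add: True eventually_at_filter)
  then show ?thesis
    by (intro continuous_eqI_eventually_at[OF assms(1,2)]) (auto elim!: eventually_mono intro: assms(3))
qed (rule assms(3))

text \<open>At a root \<beta>_j the left side vanishes and q does not, so g vanishes there and the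
  linear factor divides g. Removing one factor per induction step also accounts for repeated roots
  with their multiplicity.\<close>

lemma cancel_linear_factors:
  fixes f g q :: "complex \<Rightarrow> complex" and n :: nat
  assumes "f holomorphic_on UNIV" "g holomorphic_on UNIV" "q holomorphic_on UNIV"
    and "\<And>z. f z * (\<Prod>j=1..n. z - \<beta> j) = g z * q z"
    and "\<And>j. j \<in> {1..n} \<Longrightarrow> q (\<beta> j) \<noteq> 0"
  shows "\<exists>h. h holomorphic_on UNIV \<and> (\<forall>z. g z = h z * (\<Prod>j=1..n. z - \<beta> j)) \<and> (\<forall>z. f z = h z * q z)"
  using assms(2,4,5)
proof (induction n arbitrary: g)
  case 0
  then show ?case by auto
next
  case (Suc n)
  let ?b = "\<beta> (Suc n)"
  have "g ?b = 0"
    using Suc.prems(2)[of ?b] Suc.prems(3)[of "Suc n"] by simp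
  define g1 where "g1 z = (if z = ?b then deriv g ?b else g z / (z - ?b))" for z
  have g1_hol: "g1 holomorphic_on UNIV"
    by (rule pole_theorem_0[OF Suc.prems(1), of ?b]) (auto simp: g1_def \<open>g ?b = 0\<close>)
  have g: "g z = g1 z * (z - ?b)" for z
    using \<open>g ?b = 0\<close> by (auto simp: g1_def)
  have "f z * (\<Prod>j=1..n. z - \<beta> j) = g1 z * q z" for z
  proof (rule continuous_eqI_off_point[where F = "\<lambda>z. f z * (\<Prod>j=1..n. z - \<beta> j)"
        and G = "\<lambda>z. g1 z * q z" and b = ?b])
    show "continuous_on UNIV (\<lambda>z. f z * (\<Prod>j=1..n. z - \<beta> j))" "continuous_on UNIV (\<lambda>z. g1 z * q z)"
      using assms(1,3) g1_hol by (auto intro!: holomorphic_on_imp_continuous_on holomorphic_intros)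
    show "f w * (\<Prod>j=1..n. w - \<beta> j) = g1 w * q w" if "w \<noteq> ?b" for w
    proof -
      have "(f w * (\<Prod>j=1..n. w - \<beta> j)) * (w - ?b) = (g1 w * q w) * (w - ?b)"
        using Suc.prems(2)[of w] g[of w] by (simp add: mult_ac)
      then show ?thesis using that by simp
    qed
  qed
  from Suc.IH[OF g1_hol this] Suc.prems(3)
  obtain h where "h holomorphic_on UNIV" "\<forall>z. g1 z = h z * (\<Prod>j=1..n. z - \<beta> j)" "\<forall>z. f z = h z * q z"
    by auto
  then show ?case
    by (intro exI[of _ h]) (auto simp: g mult_ac)
qed

lemma blaschke_factor_norm_diff:
  "(cmod (z - cnj \<alpha> * of_real \<rho>))\<^sup>2 - (cmod (of_real \<rho> - \<alpha> * z))\<^sup>2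
     = (1 - (cmod \<alpha>)\<^sup>2) * ((cmod z)\<^sup>2 - \<rho>\<^sup>2)"
  unfolding cmod_power2 by (simp add: power2_eq_square algebra_simps)

lemma blaschke_factor_norm_le:
  assumes "cmod \<alpha> < 1" "\<rho> \<ge> 0" "\<rho> \<le> cmod z"
  shows "cmod (of_real \<rho> - \<alpha> * z) \<le> cmod (z - cnj \<alpha> * of_real \<rho>)"
proof (rule power2_le_imp_le)
  have "0 \<le> (1 - (cmod \<alpha>)\<^sup>2) * ((cmod z)\<^sup>2 - \<rho>\<^sup>2)"
    using assms by (intro mult_nonneg_nonneg) (simp_all add: abs_square_le_1 power_mono)
  then show "(cmod (of_real \<rho> - \<alpha> * z))\<^sup>2 \<le> (cmod (z - cnj \<alpha> * of_real \<rho>))\<^sup>2"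
    using blaschke_factor_norm_diff[of z \<alpha> \<rho>] by linarith
qed simp

text \<open>At u = \<rho>/z a Blaschke factor becomes (\<rho> - \<alpha> z) / (z -
  \<open>cnj \<alpha>\<close> \<rho>). Clearing denominators gives an identity of entire functions
  to which \<open>cancel_linear_factors\<close> applies; h is what remains of g.\<close>

lemma finite_blaschke_product_factorization:
  assumes "finite_blaschke_product n B" "\<rho> > 0"
    and f: "f holomorphic_on UNIV" and g: "g holomorphic_on UNIV"
    and eq: "meromorphic_eq f (\<lambda>z. B (of_real \<rho> / z) * g z)"
  obtains \<eta> \<alpha> h where "cmod \<eta> = 1" "\<And>j. j \<in> {1..n} \<Longrightarrow> cmod (\<alpha> j) < 1" "h holomorphic_on UNIV"
    "\<And>z. g z = h z * (\<Prod>j=1..n. z - cnj (\<alpha> j) * of_real \<rho>)"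
    "\<And>z. f z = \<eta> * (h z * (\<Prod>j=1..n. of_real \<rho> - \<alpha> j * z))"
proof -
  obtain \<eta> \<alpha> where \<eta>: "cmod \<eta> = 1" and \<alpha>: "\<And>j. j \<in> {1..n} \<Longrightarrow> cmod (\<alpha> j) < 1"
    and B: "B = (\<lambda>u. \<eta> * (\<Prod>j=1..n. (u - \<alpha> j) / (1 - cnj (\<alpha> j) * u)))"
    using assms(1) unfolding finite_blaschke_product_def by blast
  define q where "q z = \<eta> * (\<Prod>j=1..n. of_real \<rho> - \<alpha> j * z)" for z
  let ?\<beta> = "\<lambda>j. cnj (\<alpha> j) * of_real \<rho>"
  have q: "q holomorphic_on UNIV"
    unfolding q_def by (intro holomorphic_intros)
  have main: "f z * (\<Prod>j=1..n. z - ?\<beta> j) = g z * q z" for z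
  proof (rule continuous_eqI_eventually_at[where F = "\<lambda>z. f z * (\<Prod>j=1..n. z - ?\<beta> j)"
        and G = "\<lambda>z. g z * q z"])
    show "continuous_on UNIV (\<lambda>z. f z * (\<Prod>j=1..n. z - ?\<beta> j))" "continuous_on UNIV (\<lambda>z. g z * q z)"
      using f g q by (auto intro!: holomorphic_on_imp_continuous_on holomorphic_intros)
    have "\<forall>\<^sub>F w in at z. f w = B (of_real \<rho> / w) * g w"
      using eq unfolding meromorphic_eq_def by (rule eventually_cosparse_imp_eventually_at) simp
    \<comment> \<open>Excluded are 0, where \<rho>/w is a division by zero, and the poles; a finite
      set has no limit point.\<close>
    moreover have "\<forall>\<^sub>F w in at z. w \<notin> insert 0 (?\<beta> ` {1..n})"
      using islimpt_finite[of "insert 0 (?\<beta> ` {1..n})" z] by (simp only: islimpt_iff_eventually) simp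
    ultimately show "\<forall>\<^sub>F w in at z. f w * (\<Prod>j=1..n. w - ?\<beta> j) = g w * q w"
    proof eventually_elim
      case (elim w)
      then have "w \<noteq> 0" and nz: "\<And>j. j \<in> {1..n} \<Longrightarrow> w - ?\<beta> j \<noteq> 0"
        by auto
      have "(\<Prod>j=1..n. (of_real \<rho> / w - \<alpha> j) / (1 - cnj (\<alpha> j) * (of_real \<rho> / w))) * (\<Prod>j=1..n. w - ?\<beta> j)
          = (\<Prod>j=1..n. of_real \<rho> - \<alpha> j * w)"
        unfolding prod.distrib [symmetric]
      proof (rule prod.cong[OF refl])
        fix j assume "j \<in> {1..n}"
        have "1 - cnj (\<alpha> j) * (of_real \<rho> / w) = (w - ?\<beta> j) / w" "of_real \<rho> / w - \<alpha> j = (of_real \<rho> - \<alpha> j * w) / w"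
          using \<open>w \<noteq> 0\<close> by (simp_all add: diff_divide_distrib)
        then show "(of_real \<rho> / w - \<alpha> j) / (1 - cnj (\<alpha> j) * (of_real \<rho> / w)) * (w - ?\<beta> j) = of_real \<rho> - \<alpha> j * w"
          using nz[OF \<open>j \<in> {1..n}\<close>] \<open>w \<noteq> 0\<close> by simp
      qed
      then show ?case
        using elim by (simp add: B q_def mult_ac)
    qed
  qed
  have "q (?\<beta> i) \<noteq> 0" if "i \<in> {1..n}" for i
  proof -
    \<comment> \<open>A common zero of a numerator and a denominator, possibly with different
      indices, would give |\<alpha>_j| |\<alpha>_i| = 1.\<close>
    have "of_real \<rho> - \<alpha> j * ?\<beta> i \<noteq> 0" if "j \<in> {1..n}" for j
    proof
      assume "of_real \<rho> - \<alpha> j * ?\<beta> i = 0"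
      then have "\<alpha> j * cnj (\<alpha> i) = 1"
        using \<open>\<rho> > 0\<close> by (simp add: algebra_simps)
      then have "cmod (\<alpha> j) * cmod (\<alpha> i) = 1"
        by (metis complex_mod_cnj norm_mult norm_one)
      then show False
        using mult_strict_mono'[OF \<alpha>[OF \<open>j \<in> {1..n}\<close>] \<alpha>[OF \<open>i \<in> {1..n}\<close>]] by simp
    qed
    then show ?thesis
      using \<eta> by (auto simp: q_def)
  qed
  from cancel_linear_factors[OF f g q main this] obtain h where "h holomorphic_on UNIV"
    "\<And>z. g z = h z * (\<Prod>j=1..n. z - ?\<beta> j)" "\<And>z. f z = h z * q z"
    by auto
  then show ?thesis
    using \<eta> \<alpha> by (intro that[of \<eta> \<alpha> h]) (auto simp: q_def mult_ac)
qed

section \<open>Comparison of the norms of f and g\<close>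

context rotation_invariant_measure
begin

text \<open>By \<open>blaschke_factor_norm_diff\<close> the two integrals differ by the positive
  constant 1 - |\<alpha>|^2 times the integral treated in \<open>integral_entire_nonneg\<close>,
  which supplies both the inequality and its equality case.\<close>

lemma blaschke_factor_step:
  assumes k: "k holomorphic_on UNIV" and "\<rho> > 0" and \<alpha>: "cmod \<alpha> < 1"
    and int2: "integrable \<mu> (\<lambda>z. (cmod z)\<^sup>2)"
    and C: "0 \<le> (LINT z|\<mu>. (cmod z)\<^sup>2 - \<rho>\<^sup>2)"
    and int: "integrable \<mu> (\<lambda>z. (cmod ((z - cnj \<alpha> * of_real \<rho>) * k z))\<^sup>2)"
  shows "integrable \<mu> (\<lambda>z. (cmod ((of_real \<rho> - \<alpha> * z) * k z))\<^sup>2)"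
    and "(LINT z|\<mu>. (cmod ((of_real \<rho> - \<alpha> * z) * k z))\<^sup>2)
           \<le> (LINT z|\<mu>. (cmod ((z - cnj \<alpha> * of_real \<rho>) * k z))\<^sup>2)"
    and "\<not> (AE z in \<mu>. cmod z = \<rho>) \<Longrightarrow> k \<noteq> (\<lambda>_. 0) \<Longrightarrow>
         (LINT z|\<mu>. (cmod ((of_real \<rho> - \<alpha> * z) * k z))\<^sup>2)
           = (LINT z|\<mu>. (cmod ((z - cnj \<alpha> * of_real \<rho>) * k z))\<^sup>2)
         \<longleftrightarrow> (LINT z|\<mu>. (cmod z)\<^sup>2 - \<rho>\<^sup>2) = 0 \<and> (\<exists>c. k = (\<lambda>_. c))"
proof -
  let ?F = "\<lambda>z. (cmod ((of_real \<rho> - \<alpha> * z) * k z))\<^sup>2"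
  let ?G = "\<lambda>z. (cmod ((z - cnj \<alpha> * of_real \<rho>) * k z))\<^sup>2"
  have k_cont: "continuous_on UNIV k"
    using k by (rule holomorphic_on_imp_continuous_on)
  have F_cont: "continuous_on UNIV ?F"
    by (intro continuous_intros k_cont)
  \<comment> \<open>Outside the disc of radius \<rho> the new integrand is at most the old one;
    inside it is bounded by a constant, which is integrable for a finite measure.\<close>
  show F_int: "integrable \<mu> ?F"
  proof -
    have "compact (?F ` cball 0 \<rho>)"
      by (intro compact_continuous_image continuous_on_subset[OF F_cont]) auto
    then obtain M where "\<forall>x\<in>?F ` cball 0 \<rho>. norm x \<le> M"
      using compact_imp_bounded bounded_iff by blast
    then have M: "?F z \<le> M" if "cmod z \<le> \<rho>" for z
      using that by simp
    have "0 \<le> M"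
      using order_trans[OF zero_le_power2 M[of 0]] \<open>\<rho> > 0\<close> by simp
    show ?thesis
    proof (rule Bochner_Integration.integrable_bound[of \<mu> "\<lambda>z. ?G z + M"])
      show "integrable \<mu> (\<lambda>z. ?G z + M)"
        using int by simp
      show "?F \<in> borel_measurable \<mu>"
        using borel_measurable_continuous_onI[OF F_cont] by (simp cong: measurable_cong_sets add: sets_eq_borel)
      have "?F z \<le> ?G z + M" for z
      proof (cases "cmod z \<le> \<rho>")
        case True
        then show ?thesis using M[OF True] zero_le_power2 add_increasing by blast
      next
        case False
        then have "?F z \<le> ?G z"
          using \<alpha> \<open>\<rho> > 0\<close> blaschke_factor_norm_le[of \<alpha> \<rho> z]
          by (intro power_mono) (auto simp: norm_mult intro: mult_right_mono)
        then show ?thesis using \<open>0 \<le> M\<close> by linarith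
      qed
      then show "AE z in \<mu>. norm (?F z) \<le> norm (?G z + M)"
        using \<open>0 \<le> M\<close> by (intro AE_I2) simp
    qed
  qed
  have \<alpha>2: "0 < 1 - (cmod \<alpha>)\<^sup>2"
    using \<alpha> by (simp add: abs_square_less_1)
  have diff: "?G z - ?F z = (1 - (cmod \<alpha>)\<^sup>2) * (((cmod z)\<^sup>2 - \<rho>\<^sup>2) * (cmod (k z))\<^sup>2)" for z
  proof -
    have "?G z - ?F z = ((cmod (z - cnj \<alpha> * of_real \<rho>))\<^sup>2 - (cmod (of_real \<rho> - \<alpha> * z))\<^sup>2) * (cmod (k z))\<^sup>2"
      unfolding norm_mult power_mult_distrib by (rule left_diff_distrib [symmetric])
    then show ?thesis
      by (simp only: blaschke_factor_norm_diff mult.assoc)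
  qed
  have "integrable \<mu> (\<lambda>z. ?G z - ?F z)"
    using int F_int by (rule Bochner_Integration.integrable_diff)
  then have D_int: "integrable \<mu> (\<lambda>z. ((cmod z)\<^sup>2 - \<rho>\<^sup>2) * (cmod (k z))\<^sup>2)"
    unfolding diff using \<alpha>2 by simp
  have "(LINT z|\<mu>. ?G z) - (LINT z|\<mu>. ?F z) = (LINT z|\<mu>. ?G z - ?F z)"
    using int F_int by (rule Bochner_Integration.integral_diff [symmetric])
  also have "\<dots> = (1 - (cmod \<alpha>)\<^sup>2) * (LINT z|\<mu>. ((cmod z)\<^sup>2 - \<rho>\<^sup>2) * (cmod (k z))\<^sup>2)"
    unfolding diff by (rule integral_mult_right_zero)
  finally have eq: "(LINT z|\<mu>. ?G z) - (LINT z|\<mu>. ?F z)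
      = (1 - (cmod \<alpha>)\<^sup>2) * (LINT z|\<mu>. ((cmod z)\<^sup>2 - \<rho>\<^sup>2) * (cmod (k z))\<^sup>2)" .
  note entire = integral_entire_nonneg[OF k \<open>\<rho> > 0\<close> D_int int2 C]
  have "0 \<le> (1 - (cmod \<alpha>)\<^sup>2) * (LINT z|\<mu>. ((cmod z)\<^sup>2 - \<rho>\<^sup>2) * (cmod (k z))\<^sup>2)"
    using entire(1) \<alpha>2 by (intro mult_nonneg_nonneg) auto
  then show "(LINT z|\<mu>. ?F z) \<le> (LINT z|\<mu>. ?G z)"
    using eq by linarith
  assume "\<not> (AE z in \<mu>. cmod z = \<rho>)" "k \<noteq> (\<lambda>_. 0)"
  note rigid = entire(2)[OF _ this]
  have "(LINT z|\<mu>. ?F z) = (LINT z|\<mu>. ?G z)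
      \<longleftrightarrow> (1 - (cmod \<alpha>)\<^sup>2) * (LINT z|\<mu>. ((cmod z)\<^sup>2 - \<rho>\<^sup>2) * (cmod (k z))\<^sup>2) = 0"
    using eq by linarith
  also have "\<dots> \<longleftrightarrow> (LINT z|\<mu>. ((cmod z)\<^sup>2 - \<rho>\<^sup>2) * (cmod (k z))\<^sup>2) = 0"
    using \<alpha>2 by simp
  also have "\<dots> \<longleftrightarrow> (LINT z|\<mu>. (cmod z)\<^sup>2 - \<rho>\<^sup>2) = 0 \<and> (\<exists>c. k = (\<lambda>_. c))"
  proof
    assume "(LINT z|\<mu>. (cmod z)\<^sup>2 - \<rho>\<^sup>2) = 0 \<and> (\<exists>c. k = (\<lambda>_. c))"
    then obtain c where "k = (\<lambda>_. c)" "(LINT z|\<mu>. (cmod z)\<^sup>2 - \<rho>\<^sup>2) = 0"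
      by blast
    then show "(LINT z|\<mu>. ((cmod z)\<^sup>2 - \<rho>\<^sup>2) * (cmod (k z))\<^sup>2) = 0"
      by (simp only: integral_mult_left_zero mult_zero_left)
  qed (rule rigid)
  finally show "(LINT z|\<mu>. ?F z) = (LINT z|\<mu>. ?G z)
      \<longleftrightarrow> (LINT z|\<mu>. (cmod z)\<^sup>2 - \<rho>\<^sup>2) = 0 \<and> (\<exists>c. k = (\<lambda>_. c))" .
qed

text \<open>The exchanged last factor is absorbed into the entire cofactor, which is why h is
  generalized in the induction. Integrability of the intermediate function comes from
  \<open>blaschke_factor_step\<close>.\<close>

lemma blaschke_factors_norm_le:
  fixes n :: nat
  assumes "\<rho> > 0" and "\<And>j. j \<in> {1..n} \<Longrightarrow> cmod (\<alpha> j) < 1"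
    and int2: "integrable \<mu> (\<lambda>z. (cmod z)\<^sup>2)"
    and C: "0 \<le> (LINT z|\<mu>. (cmod z)\<^sup>2 - \<rho>\<^sup>2)"
    and "h holomorphic_on UNIV"
    and "integrable \<mu> (\<lambda>z. (cmod (h z * (\<Prod>j=1..n. z - cnj (\<alpha> j) * of_real \<rho>)))\<^sup>2)"
  shows "(LINT z|\<mu>. (cmod (h z * (\<Prod>j=1..n. of_real \<rho> - \<alpha> j * z)))\<^sup>2)
           \<le> (LINT z|\<mu>. (cmod (h z * (\<Prod>j=1..n. z - cnj (\<alpha> j) * of_real \<rho>)))\<^sup>2)"
  using assms(2,5,6)
proof (induction n arbitrary: h)
  case (Suc n)
  let ?a = "\<alpha> (Suc n)"
  let ?k = "\<lambda>z. h z * (\<Prod>j=1..n. z - cnj (\<alpha> j) * of_real \<rho>)"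
  let ?h = "\<lambda>z. h z * (of_real \<rho> - ?a * z)"
  have k: "?k holomorphic_on UNIV" and h: "?h holomorphic_on UNIV"
    using Suc.prems(2) by (auto intro!: holomorphic_intros)
  have a: "cmod ?a < 1" using Suc.prems(1) by simp
  have Gk: "h z * (\<Prod>j=1..Suc n. z - cnj (\<alpha> j) * of_real \<rho>) = (z - cnj ?a * of_real \<rho>) * ?k z" for z
    by (simp add: mult_ac)
  have Fk: "?h z * (\<Prod>j=1..n. z - cnj (\<alpha> j) * of_real \<rho>) = (of_real \<rho> - ?a * z) * ?k z" for z
    by (simp add: mult_ac)
  note step = blaschke_factor_step[OF k \<open>\<rho> > 0\<close> a int2 C Suc.prems(3)[unfolded Gk]]
  have "(LINT z|\<mu>. (cmod (?h z * (\<Prod>j=1..n. of_real \<rho> - \<alpha> j * z)))\<^sup>2)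
      \<le> (LINT z|\<mu>. (cmod (?h z * (\<Prod>j=1..n. z - cnj (\<alpha> j) * of_real \<rho>)))\<^sup>2)"
  proof (rule Suc.IH[OF _ h])
    show "cmod (\<alpha> j) < 1" if "j \<in> {1..n}" for j
      using that Suc.prems(1) by simp
    show "integrable \<mu> (\<lambda>z. (cmod (?h z * (\<Prod>j=1..n. z - cnj (\<alpha> j) * of_real \<rho>)))\<^sup>2)"
      unfolding Fk by (rule step(1))
  qed
  also have "\<dots> \<le> (LINT z|\<mu>. (cmod (h z * (\<Prod>j=1..Suc n. z - cnj (\<alpha> j) * of_real \<rho>)))\<^sup>2)"
    unfolding Gk Fk by (rule step(2))
  finally show ?case
    by (simp add: mult_ac)
qed simp

text \<open>The n-th factor is exchanged first and alone, with k = g / (z - b_n), and the others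
  afterwards. Equality of the outer integrals forces equality at this first exchange, so k, which
  still carries the other linear factors, is constant.\<close>

theorem blaschke_norm_le:
  fixes n :: nat
  assumes "\<rho> > 0" "n \<ge> 1" and \<alpha>: "\<And>j. j \<in> {1..n} \<Longrightarrow> cmod (\<alpha> j) < 1"
    and int2: "integrable \<mu> (\<lambda>z. (cmod z)\<^sup>2)"
    and C: "0 \<le> (LINT z|\<mu>. (cmod z)\<^sup>2 - \<rho>\<^sup>2)"
    and nAE: "\<not> (AE z in \<mu>. cmod z = \<rho>)"
    and h: "h holomorphic_on UNIV"
    and g: "\<And>z. g z = h z * (\<Prod>j=1..n. z - cnj (\<alpha> j) * of_real \<rho>)"
    and g_int: "integrable \<mu> (\<lambda>z. (cmod (g z))\<^sup>2)" and "g \<noteq> (\<lambda>_. 0)"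
    and "cmod \<eta> = 1" and f: "\<And>z. f z = \<eta> * (h z * (\<Prod>j=1..n. of_real \<rho> - \<alpha> j * z))"
  shows "(LINT z|\<mu>. (cmod (f z))\<^sup>2) \<le> (LINT z|\<mu>. (cmod (g z))\<^sup>2)"
    and "(LINT z|\<mu>. (cmod (f z))\<^sup>2) = (LINT z|\<mu>. (cmod (g z))\<^sup>2) \<longleftrightarrow>
         (LINT z|\<mu>. (cmod z)\<^sup>2 - \<rho>\<^sup>2) = 0 \<and> n = 1 \<and> (\<exists>p :: complex poly. degree p = 1 \<and> g = poly p)"
proof -
  obtain m where n: "n = Suc m"
    using \<open>n \<ge> 1\<close> by (cases n) auto
  let ?a = "\<alpha> n"
  let ?b = "cnj ?a * of_real \<rho>"
  define k where "k z = h z * (\<Prod>j=1..m. z - cnj (\<alpha> j) * of_real \<rho>)" for z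
  have k: "k holomorphic_on UNIV"
    unfolding k_def using h by (intro holomorphic_intros)
  have a: "cmod ?a < 1" using \<alpha> \<open>n \<ge> 1\<close> by simp
  have gk: "g z = (z - ?b) * k z" for z
    by (simp add: g k_def n mult_ac)
  have "k \<noteq> (\<lambda>_. 0)"
    using \<open>g \<noteq> (\<lambda>_. 0)\<close> by (auto simp: gk fun_eq_iff)
  note step = blaschke_factor_step[OF k \<open>\<rho> > 0\<close> a int2 C g_int[unfolded gk]]
  have Fk: "h z * (of_real \<rho> - ?a * z) * (\<Prod>j=1..m. z - cnj (\<alpha> j) * of_real \<rho>) = (of_real \<rho> - ?a * z) * k z" for z
    by (simp add: k_def mult_ac)
  have f': "cmod (f z) = cmod (h z * (of_real \<rho> - ?a * z) * (\<Prod>j=1..m. of_real \<rho> - \<alpha> j * z))" for z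
    by (simp add: f n norm_mult \<open>cmod \<eta> = 1\<close> mult_ac)
  have le: "(LINT z|\<mu>. (cmod (f z))\<^sup>2) \<le> (LINT z|\<mu>. (cmod ((of_real \<rho> - ?a * z) * k z))\<^sup>2)"
    unfolding f' Fk [symmetric]
  proof (rule blaschke_factors_norm_le[OF \<open>\<rho> > 0\<close> _ int2 C])
    show "cmod (\<alpha> j) < 1" if "j \<in> {1..m}" for j
      using that \<alpha> n by simp
    show "(\<lambda>z. h z * (of_real \<rho> - ?a * z)) holomorphic_on UNIV"
      using h by (intro holomorphic_intros)
    show "integrable \<mu> (\<lambda>z. (cmod (h z * (of_real \<rho> - ?a * z) * (\<Prod>j=1..m. z - cnj (\<alpha> j) * of_real \<rho>)))\<^sup>2)"
      unfolding Fk by (rule step(1))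
  qed
  then show "(LINT z|\<mu>. (cmod (f z))\<^sup>2) \<le> (LINT z|\<mu>. (cmod (g z))\<^sup>2)"
    using step(2) unfolding gk by linarith
  have iff: "(LINT z|\<mu>. (cmod ((of_real \<rho> - ?a * z) * k z))\<^sup>2) = (LINT z|\<mu>. (cmod (g z))\<^sup>2)
      \<longleftrightarrow> (LINT z|\<mu>. (cmod z)\<^sup>2 - \<rho>\<^sup>2) = 0 \<and> (\<exists>c. k = (\<lambda>_. c))"
    unfolding gk by (rule step(3)[OF nAE \<open>k \<noteq> (\<lambda>_. 0)\<close>])
  show "(LINT z|\<mu>. (cmod (f z))\<^sup>2) = (LINT z|\<mu>. (cmod (g z))\<^sup>2) \<longleftrightarrow>
      (LINT z|\<mu>. (cmod z)\<^sup>2 - \<rho>\<^sup>2) = 0 \<and> n = 1 \<and> (\<exists>p :: complex poly. degree p = 1 \<and> g = poly p)"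
  proof (intro iffI; (elim conjE)?)
    assume eq: "(LINT z|\<mu>. (cmod (f z))\<^sup>2) = (LINT z|\<mu>. (cmod (g z))\<^sup>2)"
    then have "(LINT z|\<mu>. (cmod ((of_real \<rho> - ?a * z) * k z))\<^sup>2) = (LINT z|\<mu>. (cmod (g z))\<^sup>2)"
      using le step(2) unfolding gk by linarith
    with iff obtain c where "(LINT z|\<mu>. (cmod z)\<^sup>2 - \<rho>\<^sup>2) = 0" and c: "k = (\<lambda>_. c)"
      by blast
    have "c \<noteq> 0"
      using c \<open>k \<noteq> (\<lambda>_. 0)\<close> by auto
    have "m = 0"
    proof (rule ccontr)
      assume "m \<noteq> 0"
      \<comment> \<open>If m is not 0, the factor with index 1 is still present in k and gives it a
        zero, which a nonzero constant does not have.\<close>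
      then have "k (cnj (\<alpha> 1) * of_real \<rho>) = 0"
        by (auto simp: k_def intro!: bexI[of _ 1])
      then show False
        using c \<open>c \<noteq> 0\<close> by simp
    qed
    moreover have "g = poly [:- ?b * c, c:]"
      by (auto simp: gk c algebra_simps)
    moreover have "degree [:- ?b * c, c:] = 1"
      using \<open>c \<noteq> 0\<close> by simp
    ultimately show "(LINT z|\<mu>. (cmod z)\<^sup>2 - \<rho>\<^sup>2) = 0 \<and> n = 1 \<and> (\<exists>p :: complex poly. degree p = 1 \<and> g = poly p)"
      using \<open>(LINT z|\<mu>. (cmod z)\<^sup>2 - \<rho>\<^sup>2) = 0\<close> n by (intro conjI exI[of _ "[:- ?b * c, c:]"]) simp_all
  next
    assume C0: "(LINT z|\<mu>. (cmod z)\<^sup>2 - \<rho>\<^sup>2) = 0" and "n = 1"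
      and "\<exists>p :: complex poly. degree p = 1 \<and> g = poly p"
    then obtain p :: "complex poly" where "degree p = 1" "g = poly p"
      by blast
    then obtain c0 c1 where p: "g = poly [:c0, c1:]"
      by (metis degree1_coeffs One_nat_def)
    \<comment> \<open>The factor z - b of g makes b the root of the linear polynomial; k is
      therefore its slope \<open>c1\<close>, first off b and then at b by continuity.\<close>
    have "c0 + ?b * c1 = 0"
      using gk[of ?b] by (simp add: p)
    have "k w = c1" if "w \<noteq> ?b" for w
    proof -
      have "(w - ?b) * k w = c0 + w * c1"
        using gk[of w] by (simp add: p)
      also have "\<dots> = (w - ?b) * c1"
        using \<open>c0 + ?b * c1 = 0\<close> by (simp add: algebra_simps add_eq_0_iff)
      finally show ?thesis using that by simp
    qed
    then have "k z = c1" for z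
      by (rule continuous_eqI_off_point[OF holomorphic_on_imp_continuous_on[OF k] continuous_on_const])
    then have "k = (\<lambda>_. c1)" by auto
    then have "(LINT z|\<mu>. (cmod ((of_real \<rho> - ?a * z) * k z))\<^sup>2) = (LINT z|\<mu>. (cmod (g z))\<^sup>2)"
      using iff C0 by blast
    moreover have "cmod (f z) = cmod ((of_real \<rho> - ?a * z) * k z)" for z
      using \<open>n = 1\<close> n by (simp add: f' k_def norm_mult mult_ac)
    ultimately show "(LINT z|\<mu>. (cmod (f z))\<^sup>2) = (LINT z|\<mu>. (cmod (g z))\<^sup>2)"
      by simp
  qed
qed

end

subsection \<open>Radial weights\<close>

text \<open>A Lebesgue measurable function agrees almost everywhere with a Borel one, and taking the
  maximum with 0 makes it nonnegative everywhere. A Borel density can be composed with |z|^2 without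
  loss of measurability.\<close>

lemma radial_weight_borel_version:
  assumes "radial_weight W"
  obtains V :: "real \<Rightarrow> real" where "V \<in> borel_measurable borel" "\<And>t. 0 \<le> V t"
    "AE t in lborel. indicator {0..} t * W t = V t"
proof -
  have "W \<in> borel_measurable (lebesgue_on {0..})"
    using assms by (simp add: radial_weight_def)
  then have "(\<lambda>t. indicator {0..} t *\<^sub>R W t) \<in> borel_measurable lebesgue"
    by (subst (asm) borel_measurable_restrict_space_iff) auto
  from completion_ex_borel_measurable_real[OF this]
  obtain V where [measurable]: "V \<in> borel_measurable lborel"
    and V: "AE t in lborel. indicator {0..} t *\<^sub>R W t = V t"
    by blast
  show ?thesis
  proof (rule that[of "\<lambda>t. max 0 (V t)"])
    have "0 \<le> indicator {0..} t * W t" for t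
      using assms by (auto simp: radial_weight_def indicator_def)
    with V show "AE t in lborel. indicator {0..} t * W t = max 0 (V t)"
      by (elim AE_mp, intro AE_I2) (auto simp: max_def dest: sym)
  qed auto
qed

text \<open>The image of area under |z|^2 has a density on the half-line, so null sets there pull
  back to null sets in the plane.\<close>

lemma AE_cmod_square:
  assumes "AE t in lborel. 0 \<le> t \<longrightarrow> P t"
  shows "AE z in lborel. P ((cmod z)\<^sup>2)"
proof -
  have "AE t in density lborel (\<lambda>t. ennreal (pi * indicator {0..} t)). P t"
    using assms by (subst AE_density) (auto simp: indicator_def elim!: AE_mp intro!: AE_I2)
  then show ?thesis
    unfolding distr_lborel_cmod_square [symmetric] by (rule AE_distrD[rotated]) measurable
qed

lemma
  fixes F :: "real \<Rightarrow> real"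
  assumes [measurable]: "F \<in> borel_measurable borel"
  shows integrable_cmod_square_iff:
      "integrable lborel (\<lambda>z::complex. F ((cmod z)\<^sup>2)) \<longleftrightarrow> integrable lborel (\<lambda>t. indicator {0..} t * F t)"
    and integral_cmod_square:
      "(LINT z|(lborel :: complex measure). F ((cmod z)\<^sup>2)) = pi * (LINT t|lborel. indicator {0..} t * F t)"
proof -
  have [measurable]: "(\<lambda>z::complex. (cmod z)\<^sup>2) \<in> borel_measurable lborel"
    by measurable
  have nonneg: "AE t::real in lborel. 0 \<le> pi * indicator {0..} t"
    by simp
  have "integrable lborel (\<lambda>z::complex. F ((cmod z)\<^sup>2))
      \<longleftrightarrow> integrable (distr (lborel :: complex measure) borel (\<lambda>z. (cmod z)\<^sup>2)) F"
    by (rule integrable_distr_eq [symmetric]) auto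
  also have "\<dots> \<longleftrightarrow> integrable lborel (\<lambda>t. (pi * indicator {0..} t) *\<^sub>R F t)"
    unfolding distr_lborel_cmod_square using nonneg by (intro integrable_density) auto
  finally show "integrable lborel (\<lambda>z::complex. F ((cmod z)\<^sup>2)) \<longleftrightarrow> integrable lborel (\<lambda>t. indicator {0..} t * F t)"
    by (simp add: mult.assoc)
  have "(LINT z|(lborel :: complex measure). F ((cmod z)\<^sup>2))
      = (LINT t|distr (lborel :: complex measure) borel (\<lambda>z. (cmod z)\<^sup>2). F t)"
    by (rule integral_distr [symmetric]) auto
  also have "\<dots> = (LINT t|lborel. (pi * indicator {0..} t) *\<^sub>R F t)"
    unfolding distr_lborel_cmod_square using nonneg by (intro integral_density) auto
  finally show "(LINT z|(lborel :: complex measure). F ((cmod z)\<^sup>2)) = pi * (LINT t|lborel. indicator {0..} t * F t)"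
    by (simp add: mult.assoc)
qed

text \<open>The measure has density V(|z|^2) with respect to area, V being the Borel version of W.
  Its interface translates Lebesgue integrals against W into Borel integrals, evaluates the even
  moments by t = |z|^2, and excludes concentration on a circle.\<close>

lemma radial_weight_planar_measure:
  assumes W: "radial_weight W"
  obtains \<mu> :: "complex measure" where "rotation_invariant_measure \<mu>"
    "\<And>F :: complex \<Rightarrow> real. F \<in> borel_measurable borel \<Longrightarrow> integrable lebesgue (\<lambda>z. F z * W ((cmod z)\<^sup>2)) \<Longrightarrow>
       integrable \<mu> F \<and> (LINT z|\<mu>. F z) = (LINT z|lebesgue. F z * W ((cmod z)\<^sup>2))"
    "\<And>k. integrable \<mu> (\<lambda>z. (cmod z) ^ (2 * k))"
    "\<And>k. (LINT z|\<mu>. (cmod z) ^ (2 * k)) = pi * moment W k"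
    "\<And>\<rho>. \<not> (AE z in \<mu>. cmod z = \<rho>)"
proof -
  obtain V :: "real \<Rightarrow> real" where V_meas [measurable]: "V \<in> borel_measurable borel" and V_nonneg: "\<And>t. 0 \<le> V t"
    and V: "AE t in lborel. indicator {0..} t * W t = V t"
    using radial_weight_borel_version[OF W] by blast
  let ?v = "\<lambda>z::complex. V ((cmod z)\<^sup>2)"
  define \<mu> where "\<mu> = density lborel (\<lambda>z. ennreal (?v z))"
  have [measurable]: "?v \<in> borel_measurable borel" by measurable
  have sets_\<mu>: "sets \<mu> = sets borel" by (simp add: \<mu>_def)
  have int_\<mu>: "integrable \<mu> F \<longleftrightarrow> integrable lborel (\<lambda>z. ?v z *\<^sub>R F z)"
    "(LINT z|\<mu>. F z) = (LINT z|lborel. ?v z *\<^sub>R F z)"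
    if "F \<in> borel_measurable borel" for F :: "complex \<Rightarrow> real"
    using that V_nonneg unfolding \<mu>_def by (intro integrable_density integral_density; simp)+
  have moments: "integrable lborel (\<lambda>t. indicator {0..} t * (V t * t ^ k)) \<and>
      (LINT t|lborel. indicator {0..} t * (V t * t ^ k)) = moment W k" for k
  proof -
    have int: "integrable lebesgue (\<lambda>t. indicator {0..} t *\<^sub>R (t ^ k * W t))"
      using W by (subst integrable_restrict_space [symmetric]) (auto simp: radial_weight_def)
    have ae: "AE t in lebesgue. indicator {0..} t *\<^sub>R (t ^ k * W t) = indicator {0..} t * (V t * t ^ k)"
    proof (rule AE_completion)
      show "AE t in lborel. indicator {0..} t *\<^sub>R (t ^ k * W t) = indicator {0..} t * (V t * t ^ k)"
        using V by eventually_elim (auto simp: indicator_def)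
    qed
    have m: "(\<lambda>t. indicator {0..} t * (V t * t ^ k)) \<in> borel_measurable lborel"
      by measurable
    have "integrable lebesgue (\<lambda>t. indicator {0..} t * (V t * t ^ k))"
      by (rule integrable_cong_AE_imp[OF int measurable_completion[OF m]]) (use ae in auto)
    moreover have "(LINT t|lebesgue. indicator {0..} t *\<^sub>R (t ^ k * W t)) = (LINT t|lebesgue. indicator {0..} t * (V t * t ^ k))"
      by (rule integral_cong_AE[OF borel_measurable_integrable[OF int] measurable_completion[OF m] ae])
    moreover have "moment W k = (LINT t|lebesgue. indicator {0..} t *\<^sub>R (t ^ k * W t))"
      unfolding moment_def by (subst integral_restrict_space) auto
    ultimately show ?thesis
      using m by (simp add: integrable_completion integral_completion)
  qed
  have mom_int: "integrable \<mu> (\<lambda>z. (cmod z) ^ (2 * k))" for k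
  proof -
    have "integrable lborel (\<lambda>z::complex. V ((cmod z)\<^sup>2) * ((cmod z)\<^sup>2) ^ k)"
      using moments[of k] by (subst integrable_cmod_square_iff[where F = "\<lambda>t. V t * t ^ k"]) auto
    then show ?thesis
      by (subst int_\<mu>) (auto simp: power_mult)
  qed
  have mom: "(LINT z|\<mu>. (cmod z) ^ (2 * k)) = pi * moment W k" for k
  proof -
    have "(LINT z|\<mu>. (cmod z) ^ (2 * k)) = (LINT z|(lborel::complex measure). V ((cmod z)\<^sup>2) * ((cmod z)\<^sup>2) ^ k)"
      by (subst int_\<mu>) (auto simp: power_mult)
    also have "\<dots> = pi * moment W k"
      using moments[of k] by (subst integral_cmod_square[where F = "\<lambda>t. V t * t ^ k"]) auto
    finally show ?thesis .
  qed
  have "rotation_invariant_measure \<mu>"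
  proof (intro rotation_invariant_measure.intro rotation_invariant_measure_axioms.intro finite_measureI)
    show "sets \<mu> = sets borel" by (fact sets_\<mu>)
    \<comment> \<open>The zeroth moment gives finite total mass.\<close>
    have "integrable lborel ?v"
      using mom_int[of 0] by (subst (asm) int_\<mu>) auto
    then have "(\<integral>\<^sup>+z. ennreal (?v z) \<partial>lborel) < \<infinity>"
      using V_nonneg by (simp add: integrable_iff_bounded)
    then show "emeasure \<mu> (space \<mu>) \<noteq> \<infinity>"
      unfolding \<mu>_def by (simp add: emeasure_density)
    fix t
    show "distr \<mu> borel ((*) (cis t)) = \<mu>"
    proof (rule measure_eqI)
      fix A assume "A \<in> sets (distr \<mu> borel ((*) (cis t)))"
      then have [measurable]: "A \<in> sets borel" by simp
      have [measurable]: "((*) (cis t)) \<in> borel_measurable borel" by measurable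
      have pre: "(*) (cis t) -` A \<in> sets borel"
        using measurable_sets[of "(*) (cis t)" borel borel A] by simp
      have "emeasure (distr \<mu> borel ((*) (cis t))) A = emeasure \<mu> ((*) (cis t) -` A)"
        by (subst emeasure_distr) (auto simp: \<mu>_def)
      \<comment> \<open>The density is evaluated at the rotated point, which has the same modulus,
        so that the whole integrand is a function of the rotated point.\<close>
      also have "\<dots> = (\<integral>\<^sup>+z. ennreal (?v (cis t * z)) * indicator A (cis t * z) \<partial>lborel)"
        unfolding \<mu>_def using pre
        by (subst emeasure_density) (auto simp: norm_mult indicator_def intro!: nn_integral_cong)
      also have "\<dots> = (\<integral>\<^sup>+z. ennreal (?v z) * indicator A z \<partial>lborel)"
        by (rule nn_integral_lborel_cis_mult) measurable
      also have "\<dots> = emeasure \<mu> A"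
        unfolding \<mu>_def by (subst emeasure_density) auto
      finally show "emeasure (distr \<mu> borel ((*) (cis t))) A = emeasure \<mu> A" .
    qed (simp add: sets_\<mu>)
  qed
  moreover have "integrable \<mu> F \<and> (LINT z|\<mu>. F z) = (LINT z|lebesgue. F z * W ((cmod z)\<^sup>2))"
    if F [measurable]: "F \<in> borel_measurable borel" and int: "integrable lebesgue (\<lambda>z. F z * W ((cmod z)\<^sup>2))"
    for F :: "complex \<Rightarrow> real"
  proof -
    have "AE t in lborel. 0 \<le> t \<longrightarrow> W t = V t"
      using V by eventually_elim (auto simp: indicator_def)
    then have "AE z in lborel. W ((cmod z)\<^sup>2) = ?v z"
      by (rule AE_cmod_square)
    then have ae: "AE z in lebesgue. F z * W ((cmod z)\<^sup>2) = ?v z * F z"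
      by (intro AE_completion) (auto elim!: AE_mp)
    have m: "(\<lambda>z. ?v z * F z) \<in> borel_measurable lborel"
      by measurable
    have "integrable lebesgue (\<lambda>z. ?v z * F z)"
      by (rule integrable_cong_AE_imp[OF int measurable_completion[OF m]]) (use ae in auto)
    moreover have "(LINT z|lebesgue. F z * W ((cmod z)\<^sup>2)) = (LINT z|lebesgue. ?v z * F z)"
      by (rule integral_cong_AE[OF borel_measurable_integrable[OF int] measurable_completion[OF m] ae])
    ultimately show ?thesis
      using m by (simp add: integrable_completion integral_completion int_\<mu>[OF F])
  qed
  moreover have "\<not> (AE z in \<mu>. cmod z = \<rho>)" for \<rho>
  proof
    assume "AE z in \<mu>. cmod z = \<rho>"
    then have "AE z in lborel. 0 < ?v z \<longrightarrow> cmod z = \<rho>"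
      unfolding \<mu>_def by (subst (asm) AE_density) auto
    then have "AE z::complex in lborel. 0 < V ((cmod z)\<^sup>2) \<longrightarrow> (cmod z)\<^sup>2 = \<rho>\<^sup>2"
      by eventually_elim auto
    then have "AE t in distr (lborel :: complex measure) borel (\<lambda>z. (cmod z)\<^sup>2). 0 < V t \<longrightarrow> t = \<rho>\<^sup>2"
      by (subst AE_distr_iff) auto
    then have "AE t in lborel. 0 \<le> t \<longrightarrow> 0 < V t \<longrightarrow> t = \<rho>\<^sup>2"
      unfolding distr_lborel_cmod_square by (subst (asm) AE_density) (auto simp: indicator_def elim!: AE_mp)
    \<comment> \<open>A circle corresponds to a single value of t, a null set. Concentration on it
      would make W vanish almost everywhere, against the definition of a radial weight.\<close>
    moreover have "AE t in lborel. t \<noteq> \<rho>\<^sup>2"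
      by (rule AE_lborel_singleton)
    ultimately have "AE t in lborel. 0 \<le> t \<longrightarrow> W t = 0"
      using V
    proof eventually_elim
      case (elim t)
      then show ?case using V_nonneg[of t] by (auto simp: indicator_def)
    qed
    then have "AE t in lebesgue_on {0..}. W t = 0"
      by (subst AE_restrict_space_iff) (auto intro: AE_completion)
    then show False
      using W by (simp add: radial_weight_def)
  qed
  ultimately show ?thesis
    using that mom_int mom by blast
qed

theorem proposition7p1:
  fixes W :: "real \<Rightarrow> real" and s \<rho> :: real and n :: nat
    and B f g :: "complex \<Rightarrow> complex"
  assumes "radial_weight W"
    and "moment W 0 = 1"
    and "s = moment W 1"
    and "0 < \<rho>" and "\<rho> \<le> sqrt s"
    and "n \<ge> 1"
    and "finite_blaschke_product n B"
    and "f \<in> F2 W" and "g \<in> F2 W"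
    and "g \<noteq> (\<lambda>_. 0)"
    and "meromorphic_eq f (\<lambda>z. B (of_real \<rho> / z) * g z)"
  shows "(\<forall>z. cmod z \<ge> \<rho> \<longrightarrow> cmod (f z) \<le> cmod (g z)) \<and>
         F2_norm W f \<le> F2_norm W g \<and>
         (F2_norm W f = F2_norm W g \<longleftrightarrow>
            \<rho> = sqrt s \<and> n = 1 \<and> (\<exists>p :: complex poly. degree p = 1 \<and> g = poly p))"
proof -
  obtain \<mu> :: "complex measure" where \<mu>: "rotation_invariant_measure \<mu>"
    and transfer: "\<And>F :: complex \<Rightarrow> real. F \<in> borel_measurable borel \<Longrightarrow> integrable lebesgue (\<lambda>z. F z * W ((cmod z)\<^sup>2)) \<Longrightarrow>
       integrable \<mu> F \<and> (LINT z|\<mu>. F z) = (LINT z|lebesgue. F z * W ((cmod z)\<^sup>2))"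
    and mom_int: "\<And>k. integrable \<mu> (\<lambda>z. (cmod z) ^ (2 * k))"
    and mom: "\<And>k. (LINT z|\<mu>. (cmod z) ^ (2 * k)) = pi * moment W k"
    and nAE: "\<And>\<rho>. \<not> (AE z in \<mu>. cmod z = \<rho>)"
    using radial_weight_planar_measure[OF assms(1)] by blast
  interpret rotation_invariant_measure \<mu> by (fact \<mu>)
  \<comment> \<open>From here on the norms are integrals with respect to \<open>\<mu>\<close>; the
    measurability required by \<open>transfer\<close> comes from continuity of u.\<close>
  have F2: "u holomorphic_on UNIV" "integrable \<mu> (\<lambda>z. (cmod (u z))\<^sup>2)"
    "F2_norm W u = sqrt (1 / pi * (LINT z|\<mu>. (cmod (u z))\<^sup>2))" if "u \<in> F2 W" for u
  proof -
    show u: "u holomorphic_on UNIV"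
      using that by (simp add: F2_def)
    have "(\<lambda>z. (cmod (u z))\<^sup>2) \<in> borel_measurable borel"
      by (intro borel_measurable_continuous_onI continuous_intros holomorphic_on_imp_continuous_on[OF u])
    then show "integrable \<mu> (\<lambda>z. (cmod (u z))\<^sup>2)"
      "F2_norm W u = sqrt (1 / pi * (LINT z|\<mu>. (cmod (u z))\<^sup>2))"
      using transfer[of "\<lambda>z. (cmod (u z))\<^sup>2"] that by (auto simp: F2_def F2_norm_def)
  qed
  obtain \<eta> \<alpha> h where \<eta>: "cmod \<eta> = 1" and \<alpha>: "\<And>j. j \<in> {1..n} \<Longrightarrow> cmod (\<alpha> j) < 1"
    and h: "h holomorphic_on UNIV"
    and g: "\<And>z. g z = h z * (\<Prod>j=1..n. z - cnj (\<alpha> j) * of_real \<rho>)"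
    and f: "\<And>z. f z = \<eta> * (h z * (\<Prod>j=1..n. of_real \<rho> - \<alpha> j * z))"
    using finite_blaschke_product_factorization[OF assms(7,4) F2(1)[OF assms(8)] F2(1)[OF assms(9)] assms(11)]
    by blast
  have pointwise: "cmod (f z) \<le> cmod (g z)" if "\<rho> \<le> cmod z" for z
  proof -
    have "(\<Prod>j=1..n. cmod (of_real \<rho> - \<alpha> j * z)) \<le> (\<Prod>j=1..n. cmod (z - cnj (\<alpha> j) * of_real \<rho>))"
      using blaschke_factor_norm_le[OF \<alpha>, of _ \<rho> z] that assms(4) by (intro prod_mono) auto
    then show ?thesis
      by (simp add: f g norm_mult \<eta> prod_norm [symmetric] mult_left_mono)
  qed
  have int2: "integrable \<mu> (\<lambda>z. (cmod z)\<^sup>2)"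
    using mom_int[of 1] by simp
  \<comment> \<open>The factor 1/pi of the norm is not part of \<open>\<mu>\<close>, so m_0 = 1
    corresponds to total mass pi. The sign of s - \<rho>^2 then governs both the hypothesis of the
    comparison and its equality case.\<close>
  have "(LINT z|\<mu>. (cmod z)\<^sup>2) = pi * s" "measure \<mu> (space \<mu>) = pi"
    using mom[of 1] mom[of 0] assms(2,3) by simp_all
  then have C_eq: "(LINT z|\<mu>. (cmod z)\<^sup>2 - \<rho>\<^sup>2) = pi * (s - \<rho>\<^sup>2)"
    using int2 by (simp add: algebra_simps)
  have "0 < sqrt s" using assms(4,5) by linarith
  then have "0 < s" by simp
  then have "\<rho>\<^sup>2 \<le> s"
    using power_mono[OF assms(5), of 2] assms(4) by simp
  then have C: "0 \<le> (LINT z|\<mu>. (cmod z)\<^sup>2 - \<rho>\<^sup>2)"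
    by (simp add: C_eq)
  have "(LINT z|\<mu>. (cmod z)\<^sup>2 - \<rho>\<^sup>2) = 0 \<longleftrightarrow> s = \<rho>\<^sup>2"
    by (simp add: C_eq)
  also have "\<dots> \<longleftrightarrow> \<rho> = sqrt s"
    using \<open>0 < s\<close> assms(4) by auto
  finally have C0: "(LINT z|\<mu>. (cmod z)\<^sup>2 - \<rho>\<^sup>2) = 0 \<longleftrightarrow> \<rho> = sqrt s" .
  note main = blaschke_norm_le[OF assms(4,6) \<alpha> int2 C nAE h g F2(2)[OF assms(9)] assms(10) \<eta> f]
  have "F2_norm W f \<le> F2_norm W g"
    unfolding F2(3)[OF assms(8)] F2(3)[OF assms(9)]
    using main(1) by (intro real_sqrt_le_mono mult_left_mono) auto
  moreover have "F2_norm W f = F2_norm W g \<longleftrightarrow> (LINT z|\<mu>. (cmod (f z))\<^sup>2) = (LINT z|\<mu>. (cmod (g z))\<^sup>2)"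
    unfolding F2(3)[OF assms(8)] F2(3)[OF assms(9)] by simp
  ultimately show ?thesis
    using pointwise main(2) unfolding C0 by blast
qed

end
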